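(* A Sturmian word $w$ over $\{a,b\}$ is not quasiperiodic if and only if it can be infinitely decomposed over $\{L_a, R_b\}$ or over $\{L_b, R_a\}$. In other words, a Sturmian word $w$ is not quasiperiodic if and only if there are integers $(d_k)_{k\ge 1}$ with $d_1 \geq 0$ and $d_k \geq 1$ for all $k \geq 2$ such that $$w = \lim_{n\rightarrow\infty} L_a^{d_1}R_b^{d_2} L_a^{d_3} R_b^{d_4}\cdots L_a^{d_{2n-1}} R_b^{d_{2n}}(a)$$ or $$w = \lim_{n\rightarrow\infty} L_b^{d_1}R_a^{d_2} L_b^{d_3} R_a^{d_4}\cdots L_b^{d_{2n-1}} R_a^{d_{2n}}(a).$$
   Context: Words are over the alphabet $\{a,b\}$; $|u|_a$ is the number of occurrences of $a$ in $u$. A word is balanced if $||u|_a-|v|_a|\le 1$ for any two of its factors $u,v$ of the same length. An infinite (i.e. right-infinite) word is ultimately periodic if it equals $uv^\omega$ for finite words $u$ and $v\neq\varepsilon$. A Sturmian word is an infinite balanced word over $\{a,b\}$ that is not ultimately periodic. An infinite word $w$ is quasiperiodic if there exist a finite word $u$ (a quasiperiod of $w$) and finite words $(p_n)_{n\ge 0}$ with $p_0=\varepsilon$ such that, for all $n\ge 0$, $0<|p_{n+1}|-|p_n|\le |u|$ and $p_nu$ is a prefix of $w$. The morphisms on $\{a,b\}^*$ (extended letterwise to infinite words) are: $L_a: a\mapsto a,\ b\mapsto ab$; $L_b: a\mapsto ba,\ b\mapsto b$; $R_a: a\mapsto a,\ b\mapsto ba$; $R_b: a\mapsto ab,\ b\mapsto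 b$. Juxtaposition denotes composition: $f_1f_2\cdots f_n(a)=f_1(f_2(\cdots f_n(a)\cdots))$. An infinite word $w$ can be infinitely decomposed over a set $X$ of morphisms if $w=\lim_{n\to\infty} f_1f_2\cdots f_n(a)$ for some sequence $(f_i)_{i\ge1}$ of elements of $X$. Here $\lim_{n} w_n = w$ (finite words $w_n$, infinite word $w$) means that for each $k$, for all large enough $n$, $w_n$ has length at least $k$ and has the same prefix of length $k$ as $w$. *)

theory Defs
  imports Main "HOL-Library.Omega_Words_Fun"
begin

(* The alphabet {a,b}.  Finite words are lists; right-infinite words are functions on nat,
   i.e. omega-words in the sense of Omega_Words_Fun. *)
datatype letter = A | B

definition is_prefix :: "letter list \<Rightarrow> letter word \<Rightarrow> bool" where
  "is_prefix u w \<longleftrightarrow> (\<exists>y. w = u \<frown> y)"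

definition factor :: "letter list \<Rightarrow> letter word \<Rightarrow> bool" where
  "factor u w \<longleftrightarrow> (\<exists>x y. w = x \<frown> u \<frown> y)"

definition balanced :: "letter word \<Rightarrow> bool" where
  "balanced w \<longleftrightarrow>
     (\<forall>u v. factor u w \<and> factor v w \<and> length u = length v \<longrightarrow>
        \<bar>int (count_list u A) - int (count_list v A)\<bar> \<le> 1)"

definition ultimately_periodic :: "letter word \<Rightarrow> bool" where
  "ultimately_periodic w \<longleftrightarrow> (\<exists>u v. v \<noteq> [] \<and> w = u \<frown> v\<^sup>\<omega>)"

definition sturmian :: "letter word \<Rightarrow> bool" where
  "sturmian w \<longleftrightarrow> balanced w \<and> \<not> ultimately_periodic w"

definition quasiperiod :: "letter list \<Rightarrow> letter word \<Rightarrow> bool" where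
  "quasiperiod u w \<longleftrightarrow>
     (\<exists>p :: nat \<Rightarrow> letter list. p 0 = [] \<and>
        (\<forall>n. 0 < int (length (p (Suc n))) - int (length (p n)) \<and>
             int (length (p (Suc n))) - int (length (p n)) \<le> int (length u) \<and>
             is_prefix (p n @ u) w))"

definition quasiperiodic :: "letter word \<Rightarrow> bool" where
  "quasiperiodic w \<longleftrightarrow> (\<exists>u. quasiperiod u w)"

type_synonym morphism = "letter list \<Rightarrow> letter list"

(* The morphism of the free monoid that maps the letters a and b to u and v. *)
definition morph :: "letter list \<Rightarrow> letter list \<Rightarrow> morphism" where
  "morph u v x = concat (map (case_letter u v) x)"

definition L\<^sub>a :: morphism where "L\<^sub>a = morph [A] [A, B]"
definition L\<^sub>b :: morphism where "L\<^sub>b = morph [B, A] [B]"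
definition R\<^sub>a :: morphism where "R\<^sub>a = morph [A] [B, A]"
definition R\<^sub>b :: morphism where "R\<^sub>b = morph [A, B] [B]"

(* The composition f 1 o f 2 o ... o f n; the value f 0 is not used. *)
primrec compose_upto :: "(nat \<Rightarrow> morphism) \<Rightarrow> nat \<Rightarrow> morphism" where
  "compose_upto f 0 = id"
| "compose_upto f (Suc n) = compose_upto f n \<circ> f (Suc n)"

definition word_lim :: "(nat \<Rightarrow> letter list) \<Rightarrow> letter word \<Rightarrow> bool" where
  "word_lim x w \<longleftrightarrow>
     (\<forall>k. \<exists>N. \<forall>n\<ge>N. k \<le> length (x n) \<and> take k (x n) = Omega_Words_Fun.prefix k w)"

definition infinitely_decomposed :: "morphism set \<Rightarrow> letter word \<Rightarrow> bool" where
  "infinitely_decomposed X w \<longleftrightarrow>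
     (\<exists>f. (\<forall>i\<ge>1. f i \<in> X) \<and> word_lim (\<lambda>n. compose_upto f n [A]) w)"

(* The word F^(d 1) G^(d 2) F^(d 3) G^(d 4) ... F^(d (2n-1)) G^(d (2n)) (a). *)
definition block_word :: "morphism \<Rightarrow> morphism \<Rightarrow> (nat \<Rightarrow> nat) \<Rightarrow> nat \<Rightarrow> letter list" where
  "block_word F G d n =
     compose_upto (\<lambda>i. (F ^^ d (2 * i - 1)) \<circ> (G ^^ d (2 * i))) n [A]"

end

theory Submission
  imports Defs
begin

text \<open>Let \<open>w\<close> be Sturmian and start with \<open>a\<close>. If \<open>bb\<close> is no factor and \<open>w\<close> starts with \<open>ab\<close>, then
  \<open>a b a\<^sup>K\<close> is a quasiperiod, where \<open>K\<close> is the least gap between two letters \<open>b\<close>. Hence, if \<open>w\<close> is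
  not quasiperiodic, either \<open>w = L\<^sub>a(v)\<close> (when \<open>aa\<close> is a factor) or \<open>w = R\<^sub>b(v)\<close>, where \<open>v\<close> again
  starts with \<open>a\<close>, is Sturmian, and is not quasiperiodic because nonerasing morphisms preserve
  quasiperiodicity. Iterating gives the decomposition. Conversely, \<open>L\<^sub>a\<close> and \<open>R\<^sub>b\<close> preserve Lyndon
  words, so a word directed by them has arbitrarily long Lyndon prefixes; these are unbordered, which
  excludes every quasiperiod. The pair \<open>L\<^sub>b, R\<^sub>a\<close> is obtained by exchanging the letters.\<close>

lemma letter_neq_iff [simp]: "x \<noteq> A \<longleftrightarrow> x = B" "x \<noteq> B \<longleftrightarrow> x = A"
  by (cases x; simp)+

section \<open>Prefixes and factors\<close>

lemma is_prefix_iff_prefix: "is_prefix u w \<longleftrightarrow> prefix (length u) w = u"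
proof
  assume "prefix (length u) w = u"
  then have "u \<frown> suffix (length u) w = prefix (length u) w \<frown> suffix (length u) w"
    by (simp only:)
  also have "\<dots> = w"
    by (rule prefix_suffix[symmetric])
  finally show "is_prefix u w"
    unfolding is_prefix_def by (rule exI[of _ "suffix (length u) w", OF sym])
qed (auto simp: is_prefix_def)

lemma is_prefix_iff_nth: "is_prefix u w \<longleftrightarrow> (\<forall>i<length u. w i = u ! i)"
  unfolding is_prefix_iff_prefix list_eq_iff_nth_eq by simp

lemma is_prefix_Nil [simp]: "is_prefix [] w"
  by (simp add: is_prefix_iff_nth)

lemma is_prefix_prefix [simp]: "is_prefix (prefix n w) w"
  by (simp add: is_prefix_iff_nth)

lemma is_prefix_appendD: "is_prefix (u @ v) w \<Longrightarrow> is_prefix u w"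
  by (auto simp: is_prefix_iff_nth nth_append)

lemma is_prefix_snoc: "is_prefix u w \<Longrightarrow> is_prefix (u @ [w (length u)]) w"
  by (auto simp: is_prefix_iff_nth nth_append less_Suc_eq)

lemma is_prefix_comparable:
  assumes "is_prefix u w" "is_prefix v w" "length u \<le> length v"
  shows "\<exists>z. v = u @ z"
proof
  show "v = u @ drop (length u) v"
    using assms by (auto simp: is_prefix_iff_nth nth_append list_eq_iff_nth_eq)
qed

lemma factor_iff: "factor u w \<longleftrightarrow> (\<exists>x. is_prefix (x @ u) w)"
  by (auto simp: factor_def is_prefix_def)

lemma factorI:
  assumes "\<And>j. j < length u \<Longrightarrow> w (i + j) = u ! j"
  shows "factor u w"
  unfolding factor_iff
proof
  have "w k = u ! (k - i)" if "\<not> k < i" "k < i + length u" for k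
    using assms[of "k - i"] that by simp
  then show "is_prefix (prefix i w @ u) w"
    by (auto simp: is_prefix_iff_nth nth_append)
qed

lemma factor_infix: "factor (x @ u @ y) w \<Longrightarrow> factor u w"
  unfolding factor_iff by (metis append.assoc is_prefix_appendD)

lemma is_prefix_power_iter:
  assumes "v \<noteq> []"
  shows "is_prefix (u @ concat (replicate n v)) (u \<frown> v\<^sup>\<omega>)"
proof -
  have "\<exists>y. v\<^sup>\<omega> = concat (replicate n v) \<frown> y"
  proof (induction n)
    case (Suc n)
    then obtain y where "v\<^sup>\<omega> = concat (replicate n v) \<frown> y"
      by blast
    then show ?case
      using assms iter_unroll[of v] by auto
  qed simp
  then show ?thesis
    unfolding is_prefix_def by force
qed

lemma ultimately_periodicI:
  assumes "v \<noteq> []" "\<And>n. is_prefix (u @ concat (replicate n v)) w"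
  shows "ultimately_periodic w"
proof -
  have "w i = (u \<frown> v\<^sup>\<omega>) i" for i
  proof -
    let ?x = "u @ concat (replicate (Suc i) v)"
    have "is_prefix ?x (u \<frown> v\<^sup>\<omega>)"
      by (rule is_prefix_power_iter[OF assms(1)])
    moreover have "Suc i * 1 \<le> Suc i * length v"
      using assms(1) by (intro mult_le_mono) (auto simp: Suc_le_eq)
    then have "i < length ?x"
      by (simp add: length_concat sum_list_replicate)
    ultimately show ?thesis
      using assms(2)[of "Suc i"] by (simp only: is_prefix_iff_nth)
  qed
  then show ?thesis
    using assms(1) unfolding ultimately_periodic_def by (metis ext)
qed

text \<open>Phrasing periodicity through finite prefixes makes it accessible to morphisms, which act
  here on finite words only.\<close>

lemma ultimately_periodic_iff:
  "ultimately_periodic w \<longleftrightarrow>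
     (\<exists>u v. v \<noteq> [] \<and> (\<forall>n. is_prefix (u @ concat (replicate n v)) w))"
  using is_prefix_power_iter ultimately_periodicI unfolding ultimately_periodic_def by metis

lemma eventually_constant_ultimately_periodic:
  assumes "\<And>i. i \<ge> N \<Longrightarrow> w i = c"
  shows "ultimately_periodic w"
proof (rule ultimately_periodicI)
  show "is_prefix (prefix N w @ concat (replicate n [c])) w" for n
    using assms by (auto simp: is_prefix_iff_nth nth_append)
qed simp

section \<open>Morphisms and images of infinite words\<close>

text \<open>For a monoid morphism the length condition says that no letter is erased.\<close>

definition word_morphism :: "morphism \<Rightarrow> bool" where
  "word_morphism f \<longleftrightarrow> (\<forall>x y. f (x @ y) = f x @ f y) \<and> (\<forall>x. length x \<le> length (f x))"

lemma word_morphism_append: "word_morphism f \<Longrightarrow> f (x @ y) = f x @ f y"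
  by (simp add: word_morphism_def)

lemma word_morphism_length: "word_morphism f \<Longrightarrow> length x \<le> length (f x)"
  by (simp add: word_morphism_def)

lemma word_morphism_Nil: "word_morphism f \<Longrightarrow> f [] = []"
  using word_morphism_append[of f "[]" "[]"] by simp

lemma word_morphism_Cons: "word_morphism f \<Longrightarrow> f (c # x) = f [c] @ f x"
  using word_morphism_append[of f "[c]" x] by simp

lemma word_morphism_id: "word_morphism id"
  by (simp add: word_morphism_def)

lemma word_morphism_comp: "word_morphism f \<Longrightarrow> word_morphism g \<Longrightarrow> word_morphism (f \<circ> g)"
  unfolding word_morphism_def using le_trans by fastforce

lemma word_morphism_funpow: "word_morphism f \<Longrightarrow> word_morphism (f ^^ n)"
  by (induction n) (auto intro: word_morphism_id word_morphism_comp)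

lemma word_morphism_compose_upto:
  "(\<And>i. i \<ge> 1 \<Longrightarrow> word_morphism (h i)) \<Longrightarrow> word_morphism (compose_upto h n)"
  by (induction n) (auto intro: word_morphism_id word_morphism_comp)

text \<open>\<open>image_word f v w\<close> says that \<open>w\<close> is the letterwise extension of \<open>f\<close> applied to the infinite
  word \<open>v\<close>.\<close>

definition image_word :: "morphism \<Rightarrow> letter word \<Rightarrow> letter word \<Rightarrow> bool" where
  "image_word f v w \<longleftrightarrow> (\<forall>u. is_prefix u v \<longrightarrow> is_prefix (f u) w)"

lemma image_wordD: "image_word f v w \<Longrightarrow> is_prefix u v \<Longrightarrow> is_prefix (f u) w"
  by (simp add: image_word_def)

lemma image_wordI: "(\<And>n. is_prefix (f (prefix n v)) w) \<Longrightarrow> image_word f v w"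
  by (metis image_word_def is_prefix_iff_prefix)

lemma image_word_id_eq: "image_word id v w \<Longrightarrow> v = w"
proof
  fix i assume "image_word id v w"
  then have "is_prefix (prefix (Suc i) v) w"
    by (metis image_wordD is_prefix_prefix id_apply)
  then show "v i = w i"
    by (simp add: is_prefix_iff_nth del: subseq_to_Suc)
qed

lemma image_word_comp: "image_word f v w \<Longrightarrow> image_word g u v \<Longrightarrow> image_word (f \<circ> g) u w"
  by (simp add: image_word_def)

lemma ultimately_periodic_image:
  assumes f: "word_morphism f" and "image_word f v w" "ultimately_periodic v"
  shows "ultimately_periodic w"
proof -
  obtain x y where xy: "y \<noteq> []" "\<And>n. is_prefix (x @ concat (replicate n y)) v"
    using assms(3) by (auto simp: ultimately_periodic_iff)
  have pow: "f (concat (replicate n y)) = concat (replicate n (f y))" for n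
    by (induction n) (simp_all add: word_morphism_Nil[OF f] word_morphism_append[OF f])
  show ?thesis
  proof (rule ultimately_periodicI)
    show "f y \<noteq> []"
      using xy(1) word_morphism_length[OF f, of y] by auto
    show "is_prefix (f x @ concat (replicate n (f y))) w" for n
      using image_wordD[OF assms(2) xy(2)] by (simp add: word_morphism_append[OF f] pow)
  qed
qed

text \<open>The positions \<open>p n\<close> of a quasiperiod \<open>u\<close> are carried to
  positions \<open>f (p n)\<close> of \<open>f u\<close>. Contraposed, preimages stay free of
  quasiperiods.\<close>

lemma quasiperiodic_image:
  assumes f: "word_morphism f" and im: "image_word f v w" and "quasiperiodic v"
  shows "quasiperiodic w"
proof -
  obtain u p where p: "p 0 = []"
      "\<And>n. length (p n) < length (p (Suc n))"
      "\<And>n. length (p (Suc n)) \<le> length (p n) + length u"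
      "\<And>n. is_prefix (p n @ u) v"
  proof -
    obtain u p where up: "p 0 = []" "\<forall>n. 0 < int (length (p (Suc n))) - int (length (p n)) \<and>
        int (length (p (Suc n))) - int (length (p n)) \<le> int (length u) \<and> is_prefix (p n @ u) v"
      using assms(3) unfolding quasiperiodic_def quasiperiod_def by blast
    show ?thesis
    proof (rule that[of p u])
      fix n
      show "length (p n) < length (p (Suc n))" "length (p (Suc n)) \<le> length (p n) + length u"
          "is_prefix (p n @ u) v"
        using up(2)[rule_format, of n] by auto
    qed (rule up)
  qed
  \<comment> \<open>Consecutive occurrences of \<open>u\<close> touch or overlap, so
    \<open>p (Suc n)\<close> extends \<open>p n\<close> by a nonempty prefix \<open>q\<close> of
    \<open>u\<close>, and \<open>f q\<close> is a nonempty prefix of \<open>f u\<close>.\<close>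
  have step: "length (f (p n)) < length (f (p (Suc n))) \<and>
      length (f (p (Suc n))) \<le> length (f (p n)) + length (f u)" for n
  proof -
    obtain q where q: "p (Suc n) = p n @ q"
      using is_prefix_comparable[of "p n" v "p (Suc n)"] p(2)[of n] p(4) is_prefix_appendD
        less_imp_le by blast
    obtain r where "p n @ u = p (Suc n) @ r"
      using is_prefix_comparable[of "p (Suc n)" v "p n @ u"] p(3)[of n] p(4) is_prefix_appendD
      by fastforce
    then have "u = q @ r"
      using q by simp
    moreover have "q \<noteq> []"
      using q p(2)[of n] by auto
    then have "f q \<noteq> []"
      using word_morphism_length[OF f, of q] by auto
    ultimately show ?thesis
      by (simp add: q word_morphism_append[OF f])
  qed
  have "quasiperiod (f u) w"
    unfolding quasiperiod_def
  proof (intro exI[of _ "f \<circ> p"] conjI allI)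
    show "(f \<circ> p) 0 = []"
      by (simp add: p(1) word_morphism_Nil[OF f])
  next
    fix n
    show "0 < int (length ((f \<circ> p) (Suc n))) - int (length ((f \<circ> p) n))"
      "int (length ((f \<circ> p) (Suc n))) - int (length ((f \<circ> p) n)) \<le> int (length (f u))"
      using step[of n] by auto
    show "is_prefix ((f \<circ> p) n @ f u) w"
      using image_wordD[OF im p(4)[of n]] by (simp add: word_morphism_append[OF f])
  qed
  then show ?thesis
    by (auto simp: quasiperiodic_def)
qed

section \<open>The morphisms \<open>L\<^sub>a\<close> and \<open>R\<^sub>b\<close> on finite
  words\<close>

lemma morph_simps [simp]:
  "L\<^sub>a [] = []" "L\<^sub>a (A # x) = A # L\<^sub>a x" "L\<^sub>a (B # x) = A # B # L\<^sub>a x"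
  "R\<^sub>b [] = []" "R\<^sub>b (A # x) = A # B # R\<^sub>b x" "R\<^sub>b (B # x) = B # R\<^sub>b x"
  by (simp_all add: L\<^sub>a_def R\<^sub>b_def morph_def)

lemma L\<^sub>a_append [simp]: "L\<^sub>a (x @ y) = L\<^sub>a x @ L\<^sub>a y"
  and R\<^sub>b_append [simp]: "R\<^sub>b (x @ y) = R\<^sub>b x @ R\<^sub>b y"
  by (simp_all add: L\<^sub>a_def R\<^sub>b_def morph_def)

lemma count_list_length: "count_list x A + count_list x B = length x"
proof (induction x)
  case (Cons c x)
  then show ?case by (cases c) auto
qed simp

lemma L\<^sub>a_count: "length (L\<^sub>a x) = length x + count_list x B" "count_list (L\<^sub>a x) A = length x"
proof (induction x)
  case (Cons c x)
  { case 1 with Cons show ?case by (cases c) auto next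
    case 2 with Cons show ?case by (cases c) auto }
qed simp_all

lemma R\<^sub>b_count: "length (R\<^sub>b x) = length x + count_list x A" "count_list (R\<^sub>b x) A = count_list x A"
proof (induction x)
  case (Cons c x)
  { case 1 with Cons show ?case by (cases c) auto next
    case 2 with Cons show ?case by (cases c) auto }
qed simp_all

lemma word_morphism_L\<^sub>a: "word_morphism L\<^sub>a" and word_morphism_R\<^sub>b: "word_morphism R\<^sub>b"
  by (simp_all add: word_morphism_def L\<^sub>a_count R\<^sub>b_count)

section \<open>Desubstitution of balanced words\<close>

text \<open>In an unbalanced pair of least length, deleting the first letters must repair the
  imbalance. Hence the word poorer in \<open>A\<close> starts with \<open>B\<close>, the other one
  with \<open>A\<close>, and the remainders differ by exactly one.\<close>

lemma minimal_unbalanced_pair: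
  assumes "\<not> balanced w"
  obtains u v where "factor (B # u) w" "factor (A # v) w" "length u = length v"
    "count_list v A = Suc (count_list u A)"
proof -
  define P where "P n \<longleftrightarrow> (\<exists>u v. factor u w \<and> factor v w \<and> length u = n \<and> length v = n \<and>
    count_list u A + 2 \<le> count_list v A)" for n
  obtain x y where xy: "factor x w" "factor y w" "length x = length y"
      "\<bar>int (count_list x A) - int (count_list y A)\<bar> > 1"
    using assms by (auto simp: balanced_def)
  have "P (length x)"
  proof (cases "count_list x A < count_list y A")
    case True
    then show ?thesis
      using xy unfolding P_def by (intro exI[of _ x] exI[of _ y]) auto
  next
    case False
    then show ?thesis
      using xy unfolding P_def by (intro exI[of _ y] exI[of _ x]) auto
  qed
  then obtain n where n: "P n" "\<And>m. m < n \<Longrightarrow> \<not> P m"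
    using exists_least_iff[of P] by blast
  then obtain u v where uv: "factor u w" "factor v w" "length u = n" "length v = n"
      "count_list u A + 2 \<le> count_list v A"
    unfolding P_def by blast
  have "u \<noteq> []" "v \<noteq> []"
    using uv by auto
  then obtain c u' d v' where eq: "u = c # u'" "v = d # v'"
    by (meson neq_Nil_conv)
  have fac: "factor u' w" "factor v' w"
    using uv(1,2) eq factor_infix[of "[c]" u' "[]"] factor_infix[of "[d]" v' "[]"] by auto
  have len: "length u' = n - 1" "length v' = n - 1" "n - 1 < n"
    using uv(3,4) eq by auto
  have "\<not> count_list u' A + 2 \<le> count_list v' A"
    using n(2)[OF len(3)] fac len unfolding P_def by blast
  then have "c = B" "d = A" "count_list v' A = Suc (count_list u' A)"
    using uv(5) unfolding eq by (cases c; cases d; auto)+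
  then show ?thesis
    using that uv eq by auto
qed

text \<open>A minimal pair \<open>B # x\<close>, \<open>A # y\<close> yields the factors
  \<open>B # L\<^sub>a x\<close> and \<open>L\<^sub>a (A # y) @ [A]\<close> of \<open>w\<close>: the
  first image loses its leading \<open>A\<close>, the second gains the \<open>A\<close> that starts
  the next letter image. The lengths agree, but the counts of \<open>A\<close> differ by
  two.\<close>

lemma balanced_L\<^sub>a_preimage:
  assumes im: "image_word L\<^sub>a v w" and "balanced w"
  shows "balanced v"
proof (rule ccontr)
  assume "\<not> balanced v"
  then obtain x y where xy: "factor (B # x) v" "factor (A # y) v" "length x = length y"
      "count_list y A = Suc (count_list x A)"
    by (rule minimal_unbalanced_pair)
  \<comment> \<open>Both letter images begin with \<open>A\<close>, so the image of any prefix of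
    \<open>v\<close> is followed by \<open>A\<close> in \<open>w\<close>.\<close>
  have next_A: "\<exists>s. is_prefix (L\<^sub>a u @ [A] @ s) w" if "is_prefix u v" for u
  proof -
    have "is_prefix (L\<^sub>a (u @ [v (length u)])) w"
      by (rule image_wordD[OF im is_prefix_snoc[OF that]])
    then show ?thesis
      by (cases "v (length u)") auto
  qed
  obtain p where "is_prefix (p @ B # x) v"
    using xy(1) by (auto simp: factor_iff)
  from next_A[OF this] obtain s where "is_prefix ((L\<^sub>a p @ [A]) @ (B # L\<^sub>a x) @ [A] @ s) w"
    by auto
  then have 1: "factor (B # L\<^sub>a x) w"
    by (metis append.assoc factor_iff is_prefix_appendD)
  obtain p where "is_prefix (p @ A # y) v"
    using xy(2) by (auto simp: factor_iff)
  from next_A[OF this] obtain s where "is_prefix (L\<^sub>a p @ (L\<^sub>a (A # y) @ [A]) @ s) w"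
    by auto
  then have 2: "factor (L\<^sub>a (A # y) @ [A]) w"
    by (metis append.assoc factor_iff is_prefix_appendD)
  have "length (B # L\<^sub>a x) = length (L\<^sub>a (A # y) @ [A])"
    using xy(3,4) count_list_length[of x] count_list_length[of y] by (simp add: L\<^sub>a_count)
  with 1 2 assms(2) have
    "\<bar>int (count_list (B # L\<^sub>a x) A) - int (count_list (L\<^sub>a (A # y) @ [A]) A)\<bar> \<le> 1"
    unfolding balanced_def by blast
  then show False
    using xy(3) by (simp add: L\<^sub>a_count)
qed

lemma R\<^sub>b_ends_with_B: "x \<noteq> [] \<Longrightarrow> \<exists>y. R\<^sub>b x = y @ [B]"
proof (induction x rule: rev_induct)
  case (snoc c x)
  then show ?case by (cases c) auto
qed simp

text \<open>Now both letter images end with \<open>B\<close>: \<open>R\<^sub>b (B # x)\<close> gains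
  the last letter of the preceding image, and \<open>R\<^sub>b (A # y)\<close> loses its final
  \<open>B\<close>. Again the lengths agree and the counts of \<open>A\<close> differ by
  two.\<close>

lemma balanced_R\<^sub>b_preimage:
  assumes im: "image_word R\<^sub>b v w" and "balanced w" and "v 0 = A"
  shows "balanced v"
proof (rule ccontr)
  assume "\<not> balanced v"
  then obtain x y where xy: "factor (B # x) v" "factor (A # y) v" "length x = length y"
      "count_list y A = Suc (count_list x A)"
    by (rule minimal_unbalanced_pair)
  obtain p where p: "is_prefix (p @ B # x) v"
    using xy(1) by (auto simp: factor_iff)
  \<comment> \<open>As \<open>v\<close> starts with \<open>A\<close>, the factor
    \<open>B # x\<close> is preceded by a letter, whose image supplies the extra
    \<open>B\<close>.\<close>
  then have "p \<noteq> []"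
    using assms(3) by (auto simp: is_prefix_iff_nth)
  then obtain q where "R\<^sub>b p = q @ [B]"
    using R\<^sub>b_ends_with_B by blast
  then have "is_prefix (q @ (B # R\<^sub>b (B # x))) w"
    using image_wordD[OF im p] by simp
  then have 1: "factor (B # R\<^sub>b (B # x)) w"
    by (metis factor_iff)
  obtain p where p: "is_prefix (p @ A # y) v"
    using xy(2) by (auto simp: factor_iff)
  obtain z where z: "R\<^sub>b (A # y) = z @ [B]"
    using R\<^sub>b_ends_with_B by blast
  have "is_prefix (R\<^sub>b p @ z @ [B]) w"
    using image_wordD[OF im p] z by simp
  then have 2: "factor z w"
    by (metis append.assoc factor_iff is_prefix_appendD)
  have len: "length z = length (R\<^sub>b (A # y)) - 1" "count_list z A = count_list (R\<^sub>b (A # y)) A"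
    unfolding z by simp_all
  have "length (B # R\<^sub>b (B # x)) = length z"
    unfolding len using xy(3,4) by (simp add: R\<^sub>b_count)
  with 1 2 assms(2) have "\<bar>int (count_list (B # R\<^sub>b (B # x)) A) - int (count_list z A)\<bar> \<le> 1"
    unfolding balanced_def by blast
  then show False
    unfolding len using xy(4) by (simp add: R\<^sub>b_count)
qed

lemma balanced_not_AA_and_BB:
  assumes "balanced w" "w i = A" "w (Suc i) = A" "w j = B" "w (Suc j) = B"
  shows False
proof -
  have "factor [A, A] w" "factor [B, B] w"
    using assms by (auto intro!: factorI[of "[A, A]" w i] factorI[of "[B, B]" w j]
        simp: less_Suc_eq)
  then have "\<bar>int (count_list [A, A] A) - int (count_list [B, B] A)\<bar> \<le> 1"
    using assms(1)[unfolded balanced_def, rule_format, of "[A, A]" "[B, B]"] by simp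
  then show False
    by simp
qed

section \<open>Existence of preimages, and the quasiperiod of words starting with
  \<open>AB\<close>\<close>

lemma L\<^sub>a_preimage_exists:
  assumes "w 0 = A" "\<And>i. w i = B \<Longrightarrow> w (Suc i) = A"
  obtains v where "image_word L\<^sub>a v w" "v 0 = w 1"
proof -
  \<comment> \<open>\<open>pos n\<close> is where the block coding \<open>v n\<close> starts. The
    block \<open>AB\<close> codes \<open>B\<close> and a lone \<open>A\<close> codes
    \<open>A\<close>, so the letter after the initial \<open>A\<close> decides.\<close>
  define pos where "pos = rec_nat 0 (\<lambda>_ p. if w (Suc p) = B then p + 2 else p + 1)"
  have pos: "pos 0 = 0" "pos (Suc n) = (if w (Suc (pos n)) = B then pos n + 2 else pos n + 1)" for n
    by (simp_all add: pos_def)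
  define v where "v n = w (Suc (pos n))" for n
  have posA: "w (pos n) = A" for n
    by (induction n) (use assms in \<open>auto simp: pos\<close>)
  have "L\<^sub>a (prefix n v) = prefix (pos n) w" for n
  proof (induction n)
    case (Suc n)
    then show ?case
      by (cases "w (Suc (pos n))") (auto simp: v_def pos posA)
  qed (simp add: pos)
  then have "image_word L\<^sub>a v w"
    by (intro image_wordI) simp
  then show ?thesis
    using that by (simp add: v_def pos)
qed

lemma R\<^sub>b_preimage_exists:
  assumes "\<And>i. w i = A \<Longrightarrow> w (Suc i) = B"
  obtains v where "image_word R\<^sub>b v w" "v 0 = w 0"
proof -
  \<comment> \<open>The blocks are now \<open>AB\<close> and \<open>B\<close>; the first letter of a
    block is the letter it codes.\<close>
  define pos where "pos = rec_nat 0 (\<lambda>_ p. if w p = A then p + 2 else p + 1)"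
  have pos: "pos 0 = 0" "pos (Suc n) = (if w (pos n) = A then pos n + 2 else pos n + 1)" for n
    by (simp_all add: pos_def)
  define v where "v n = w (pos n)" for n
  have "R\<^sub>b (prefix n v) = prefix (pos n) w" for n
  proof (induction n)
    case (Suc n)
    then show ?case
      by (cases "w (pos n)") (auto simp: v_def pos assms)
  qed (simp add: pos)
  then have "image_word R\<^sub>b v w"
    by (intro image_wordI) simp
  then show ?thesis
    using that by (simp add: v_def pos)
qed

text \<open>The gaps between consecutive letters \<open>B\<close> take only the values \<open>K\<close> and \<open>K + 1\<close>, where \<open>K\<close> is
  the least gap, so \<open>A B A\<^sup>K\<close> is a quasiperiod.\<close>

lemma quasiperiodic_if_starts_with_AB:
  assumes bal: "balanced w" and per: "\<not> ultimately_periodic w"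
    and start: "w 0 = A" "w 1 = B" and noBB: "\<And>i. w i = B \<Longrightarrow> w (Suc i) = A"
  shows "quasiperiodic w"
proof -
  define S where "S = {i. w i = B}"
  have inf: "infinite S"
  proof
    assume "finite S"
    then obtain N where "\<And>i. i \<in> S \<Longrightarrow> i < N"
      using finite_nat_set_iff_bounded by auto
    then have "w i = A" if "i \<ge> N" for i
      using that letter_neq_iff(1) unfolding S_def by (metis (mono_tags) leD mem_Collect_eq)
    then show False
      using eventually_constant_ultimately_periodic per by blast
  qed
  define b where "b = enumerate S"
  have bB: "w (b n) = B" for n
    using enumerate_in_set[OF inf, of n] by (simp add: S_def b_def)
  have b_less: "b n < b (Suc n)" for n
    unfolding b_def by (rule enumerate_step[OF inf])
  have between: "w i = A" if "b n < i" "i < b (Suc n)" for n i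
  proof (rule ccontr)
    assume "w i \<noteq> A"
    then have "i \<in> S"
      by (simp add: S_def)
    then show False
      using that enumerate_Suc''[OF inf, of n] not_less_Least[of i] unfolding b_def by auto
  qed
  have b0: "b 0 = 1"
    unfolding b_def enumerate_0
  proof (rule Least_equality)
    fix y assume "y \<in> S"
    then show "1 \<le> y"
      using start(1) by (cases y) (auto simp: S_def)
  qed (use start in \<open>auto simp: S_def\<close>)
  define g where "g n = b (Suc n) - b n - 1" for n
  have bg: "b (Suc n) = b n + g n + 1" for n
    using b_less[of n] by (simp add: g_def)
  define K where "K = (LEAST k. \<exists>n. g n = k)"
  have "\<exists>m. g m = K"
    unfolding K_def by (rule LeastI[of _ "g 0"]) blast
  then obtain m where m: "g m = K"
    by blast
  have K_le: "K \<le> g n" for n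
    unfolding K_def by (rule Least_le) blast
  \<comment> \<open>A longer gap would give the factor \<open>?x\<close>, to be compared with
    \<open>?y\<close> around a minimal gap: equal lengths, but counts of \<open>A\<close> that
    differ by two.\<close>
  have le_K: "g n \<le> K + 1" for n
  proof (rule ccontr)
    assume less: "\<not> g n \<le> K + 1"
    let ?x = "replicate (K + 2) A" and ?y = "B # replicate K A @ [B]"
    have "factor ?x w"
    proof (rule factorI[of _ _ "Suc (b n)"])
      fix j assume "j < length ?x"
      then show "w (Suc (b n) + j) = ?x ! j"
        using between[of n "Suc (b n) + j"] less by (simp add: bg del: replicate.simps)
    qed
    moreover have "factor ?y w"
    proof (rule factorI[of _ _ "b m"])
      fix j assume "j < length ?y"
      then consider "j = 0" | "1 \<le> j" "j \<le> K" | "j = K + 1"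
        by fastforce
      then show "w (b m + j) = ?y ! j"
      proof cases
        case 2
        then show ?thesis
          using between[of m "b m + j"] m by (cases j) (auto simp: bg nth_append)
      next
        case 3
        then show ?thesis
          using bB[of "Suc m"] m by (simp add: bg nth_append)
      qed (simp add: bB)
    qed
    ultimately have "\<bar>int (count_list ?x A) - int (count_list ?y A)\<bar> \<le> 1"
      using bal[unfolded balanced_def, rule_format, of ?x ?y] by simp
    moreover have "count_list (replicate k A) A = k" for k
      by (induction k) auto
    ultimately show False
      by simp
  qed
  \<comment> \<open>Every \<open>B\<close> has a predecessor, as \<open>w\<close> starts with
    \<open>A\<close>, and this is an \<open>A\<close>, as \<open>BB\<close> does not occur.\<close>
  have before: "w (b n - 1) = A" "b n > 0" for n
  proof -
    show pos: "b n > 0"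
      using b_less[of "n - 1"] b0 by (cases n) auto
    then show "w (b n - 1) = A"
      using noBB[of "b n - 1"] bB[of n] by (cases "w (b n - 1)") auto
  qed
  let ?u = "A # B # replicate K A"
  have "quasiperiod ?u w"
    unfolding quasiperiod_def
  \<comment> \<open>Each occurrence of \<open>?u\<close> starts at the \<open>A\<close> before a
    \<open>B\<close>, the first one at position 0. Consecutive starts are \<open>g n + 1\<close>
    apart, at most the length \<open>K + 2\<close> of \<open>?u\<close>.\<close>
  proof (intro exI[of _ "\<lambda>n. prefix (b n - 1) w"] conjI allI)
    show "prefix (b 0 - 1) w = []"
      by (simp add: b0)
  next
    fix n
    show "0 < int (length (prefix (b (Suc n) - 1) w)) - int (length (prefix (b n - 1) w))"
      "int (length (prefix (b (Suc n) - 1) w)) - int (length (prefix (b n - 1) w))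
        \<le> int (length ?u)"
      using before(2)[of n] le_K[of n] by (auto simp: bg)
    show "is_prefix (prefix (b n - 1) w @ ?u) w"
      unfolding is_prefix_iff_nth
    proof (intro allI impI)
      fix i assume i: "i < length (prefix (b n - 1) w @ ?u)"
      consider "i < b n - 1" | "i = b n - 1" | "i = b n" | "b n < i"
        by linarith
      then show "w i = (prefix (b n - 1) w @ ?u) ! i"
      proof cases
        case 4
        then obtain j where "i = b n + Suc j"
          using less_iff_Suc_add by auto
        moreover from this have "j < K"
          using i before(2)[of n] by simp
        ultimately show ?thesis
          using between[of n i] K_le[of n] before(2)[of n] by (auto simp: bg nth_append)
      qed (use bB before[of n] in \<open>auto simp: nth_append\<close>)
    qed
  qed
  then show ?thesis
    by (auto simp: quasiperiodic_def)
qed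

section \<open>Desubstitution of Sturmian words that start with \<open>A\<close> and are not
  quasiperiodic\<close>

definition nonqp_sturmian :: "letter word \<Rightarrow> bool" where
  "nonqp_sturmian w \<longleftrightarrow> sturmian w \<and> w 0 = A \<and> \<not> quasiperiodic w"

definition has_AA :: "letter word \<Rightarrow> bool" where
  "has_AA w \<longleftrightarrow> (\<exists>i. w i = A \<and> w (Suc i) = A)"

lemma nonqp_sturmian_L\<^sub>a_preimage:
  assumes "nonqp_sturmian w" "has_AA w"
  obtains v where "nonqp_sturmian v" "image_word L\<^sub>a v w"
proof -
  have w: "balanced w" "\<not> ultimately_periodic w" "w 0 = A" "\<not> quasiperiodic w"
    using assms(1) by (auto simp: nonqp_sturmian_def sturmian_def)
  have noBB: "w (Suc i) = A" if "w i = B" for i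
    using assms(2) balanced_not_AA_and_BB[OF w(1)] that unfolding has_AA_def
    by (metis letter.exhaust)
  obtain v where v: "image_word L\<^sub>a v w" "v 0 = w 1"
    using L\<^sub>a_preimage_exists[OF w(3) noBB] by blast
  \<comment> \<open>A start \<open>AB\<close> would make \<open>w\<close> quasiperiodic. So
    \<open>w\<close> starts with \<open>AA\<close>, and \<open>v\<close>, whose first letter is
    \<open>w 1\<close>, starts with \<open>A\<close>.\<close>
  have "w 1 \<noteq> B"
    using quasiperiodic_if_starts_with_AB[OF w(1-3) _ noBB] w(4) by blast
  then have "nonqp_sturmian v"
    using v w balanced_L\<^sub>a_preimage ultimately_periodic_image[OF word_morphism_L\<^sub>a]
      quasiperiodic_image[OF word_morphism_L\<^sub>a] by (auto simp: nonqp_sturmian_def sturmian_def)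
  then show ?thesis
    using that v(1) by blast
qed

lemma nonqp_sturmian_R\<^sub>b_preimage:
  assumes "nonqp_sturmian w" "\<not> has_AA w"
  obtains v where "nonqp_sturmian v" "image_word R\<^sub>b v w"
proof -
  obtain v where v: "image_word R\<^sub>b v w" "v 0 = w 0"
    using R\<^sub>b_preimage_exists[of w] assms(2) unfolding has_AA_def by (metis letter.exhaust)
  then have "nonqp_sturmian v"
    using assms(1) balanced_R\<^sub>b_preimage ultimately_periodic_image[OF word_morphism_R\<^sub>b]
      quasiperiodic_image[OF word_morphism_R\<^sub>b] by (auto simp: nonqp_sturmian_def sturmian_def)
  then show ?thesis
    using that v(1) by blast
qed

section \<open>Bounds on the powers of \<open>L\<^sub>a\<close> and \<open>R\<^sub>b\<close> that
  can be removed\<close>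

lemma L\<^sub>a_funpow: "(L\<^sub>a ^^ d) (replicate k A @ [B]) = replicate (k + d) A @ [B]"
proof (induction d)
  case (Suc d)
  have "L\<^sub>a (replicate n A @ [B]) = replicate (Suc n) A @ [B]" for n
    by (induction n) auto
  with Suc show ?case
    by simp
qed simp

lemma L\<^sub>a_funpow_A [simp]: "(L\<^sub>a ^^ d) [A] = [A]"
  and R\<^sub>b_funpow_B [simp]: "(R\<^sub>b ^^ d) [B] = [B]"
  by (induction d) simp_all

lemma R\<^sub>b_funpow: "(R\<^sub>b ^^ d) [A] = A # replicate d B"
proof (induction d)
  case (Suc d)
  have "R\<^sub>b (replicate n B) = replicate n B" for n
    by (induction n) auto
  with Suc show ?case
    by simp
qed simp

lemma sturmian_contains:
  assumes "sturmian w"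
  shows "\<exists>i\<ge>n. w i = c"
proof (rule ccontr)
  assume *: "\<not> (\<exists>i\<ge>n. w i = c)"
  define d where "d = (case c of A \<Rightarrow> B | B \<Rightarrow> A)"
  have "w i = d" if "i \<ge> n" for i
    using * that unfolding d_def by (cases c; cases "w i") auto
  then show False
    using eventually_constant_ultimately_periodic[of n w d] assms
    unfolding sturmian_def by blast
qed

text \<open>A Sturmian \<open>v\<close> has a prefix \<open>replicate k A @ [B]\<close>, and
  \<open>L\<^sub>a ^^ d\<close> adds \<open>d\<close> letters \<open>A\<close> in front of it. So
  the position of any \<open>B\<close> in \<open>w\<close> bounds \<open>d\<close>.\<close>

lemma L\<^sub>a_power_bounded:
  assumes "sturmian w"
  obtains D where "\<And>d v. image_word (L\<^sub>a ^^ d) v w \<Longrightarrow> sturmian v \<Longrightarrow> d \<le> D"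
proof -
  obtain i where i: "w i = B"
    using sturmian_contains[OF assms] by blast
  have "d \<le> i" if "image_word (L\<^sub>a ^^ d) v w" "sturmian v" for d v
  proof (rule ccontr)
    assume less: "\<not> d \<le> i"
    define k where "k = (LEAST k. v k = B)"
    have "v k = B"
      unfolding k_def using sturmian_contains[OF that(2), of 0 B] by (auto intro: LeastI)
    moreover have "v j = A" if "j < k" for j
      using not_less_Least[OF that[unfolded k_def]] by simp
    ultimately have "is_prefix (replicate k A @ [B]) v"
      by (auto simp: is_prefix_iff_nth nth_append less_Suc_eq)
    from image_wordD[OF that(1) this] have "is_prefix (replicate (k + d) A @ [B]) w"
      by (simp add: L\<^sub>a_funpow)
    then have "w i = A"
      using less by (auto simp: is_prefix_iff_nth nth_append split: if_splits)
    with i show False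
      by simp
  qed
  then show ?thesis
    using that by blast
qed

text \<open>\<open>w\<close> starts with \<open>A # replicate d B\<close>, so any \<open>A\<close>
  of \<open>w\<close> after the first position bounds \<open>d\<close>.\<close>

lemma R\<^sub>b_power_bounded:
  assumes "sturmian w"
  obtains D where "\<And>d v. image_word (R\<^sub>b ^^ d) v w \<Longrightarrow> v 0 = A \<Longrightarrow> d \<le> D"
proof -
  obtain i where i: "i \<ge> 1" "w i = A"
    using sturmian_contains[OF assms] by blast
  have "d \<le> i" if "image_word (R\<^sub>b ^^ d) v w" "v 0 = A" for d v
  proof (rule ccontr)
    assume less: "\<not> d \<le> i"
    have "is_prefix [A] v"
      using that by (simp add: is_prefix_iff_nth)
    from image_wordD[OF that(1) this] have "is_prefix (A # replicate d B) w"
      by (simp add: R\<^sub>b_funpow)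
    then have "w i = B"
      using less i(1) by (cases i) (auto simp: is_prefix_iff_nth)
    with i show False
      by simp
  qed
  then show ?thesis
    using that by blast
qed

text \<open>\<open>L\<^sub>a\<close> is removed while \<open>AA\<close> occurs, then
  \<open>R\<^sub>b\<close> until \<open>AA\<close> occurs again; the bounds on powers end both
  phases. The factor \<open>AA\<close> of \<open>v\<close> ensures that the next block starts with a
  positive exponent.\<close>

lemma nonqp_sturmian_block_preimage:
  assumes "nonqp_sturmian w"
  obtains v d e where "nonqp_sturmian v" "has_AA v" "has_AA w \<Longrightarrow> d \<ge> 1" "e \<ge> 1"
    "image_word (L\<^sub>a ^^ d \<circ> R\<^sub>b ^^ e) v w"
proof -
  have "\<exists>d v. nonqp_sturmian v \<and> \<not> has_AA v \<and> image_word (L\<^sub>a ^^ d) v w"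
  proof (rule ccontr)
    assume *: "\<not> ?thesis"
    have ex: "\<exists>v. nonqp_sturmian v \<and> image_word (L\<^sub>a ^^ d) v w" for d
    proof (induction d)
      case 0
      show ?case using assms by (auto simp: image_word_def)
    next
      case (Suc d)
      then obtain v where v: "nonqp_sturmian v" "image_word (L\<^sub>a ^^ d) v w"
        by blast
      with * obtain u where "nonqp_sturmian u" "image_word L\<^sub>a u v"
        using nonqp_sturmian_L\<^sub>a_preimage by blast
      with v(2) show ?case
        unfolding funpow_Suc_right using image_word_comp by blast
    qed
    obtain D where "\<And>d v. image_word (L\<^sub>a ^^ d) v w \<Longrightarrow> sturmian v \<Longrightarrow> d \<le> D"
      using L\<^sub>a_power_bounded assms by (auto simp: nonqp_sturmian_def)
    with ex[of "Suc D"] show False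
      unfolding nonqp_sturmian_def by fastforce
  qed
  then obtain d u where u: "nonqp_sturmian u" "\<not> has_AA u" "image_word (L\<^sub>a ^^ d) u w"
    by blast
  have "\<exists>e v. nonqp_sturmian v \<and> has_AA v \<and> image_word (R\<^sub>b ^^ e) v u"
  proof (rule ccontr)
    assume *: "\<not> ?thesis"
    have ex: "\<exists>v. nonqp_sturmian v \<and> image_word (R\<^sub>b ^^ e) v u" for e
    proof (induction e)
      case 0
      show ?case using u(1) by (auto simp: image_word_def)
    next
      case (Suc e)
      then obtain v where v: "nonqp_sturmian v" "image_word (R\<^sub>b ^^ e) v u"
        by blast
      with * obtain x where "nonqp_sturmian x" "image_word R\<^sub>b x v"
        using nonqp_sturmian_R\<^sub>b_preimage by blast
      with v(2) show ?case
        unfolding funpow_Suc_right using image_word_comp by blast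
    qed
    obtain D where "\<And>d v. image_word (R\<^sub>b ^^ d) v u \<Longrightarrow> v 0 = A \<Longrightarrow> d \<le> D"
      using R\<^sub>b_power_bounded u(1) by (auto simp: nonqp_sturmian_def)
    with ex[of "Suc D"] show False
      unfolding nonqp_sturmian_def by fastforce
  qed
  then obtain e v where v: "nonqp_sturmian v" "has_AA v" "image_word (R\<^sub>b ^^ e) v u"
    by blast
  show ?thesis
  proof (rule that[of v d e])
    show "d \<ge> 1" if "has_AA w"
    proof (rule ccontr)
      assume "\<not> d \<ge> 1"
      then have "d = 0"
        by simp
      then have "image_word id u w"
        using u(3) by simp
      then show False
        using image_word_id_eq u(2) that by blast
    qed
    \<comment> \<open>\<open>e = 0\<close> would make \<open>u\<close> and \<open>v\<close> equal,
      but only \<open>v\<close> contains \<open>AA\<close>.\<close>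
    show "e \<ge> 1"
    proof (rule ccontr)
      assume "\<not> e \<ge> 1"
      then have "e = 0"
        by simp
      then have "image_word id v u"
        using v(3) by simp
      then show False
        using image_word_id_eq u(2) v(2) by blast
    qed
  qed (use v u image_word_comp in blast)+
qed

section \<open>Lyndon words are unbordered\<close>

text \<open>Lexicographic order with \<open>A\<close> before \<open>B\<close>, without the case that
  one word is a prefix of the other.\<close>

definition strict_less :: "letter list \<Rightarrow> letter list \<Rightarrow> bool" where
  "strict_less u v \<longleftrightarrow> (\<exists>x y z. u = x @ A # y \<and> v = x @ B # z)"

text \<open>The Lyndon words other than the single letter \<open>B\<close>. A proper suffix is
  shorter than the word, so being larger always rests on a differing letter, as
  \<open>strict_less\<close> demands.\<close>

definition lyndon :: "letter list \<Rightarrow> bool" where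
  "lyndon u \<longleftrightarrow> (\<exists>z. u = A # z) \<and> (\<forall>x s. u = x @ s \<and> x \<noteq> [] \<and> s \<noteq> [] \<longrightarrow> strict_less u s)"

lemma lyndon_A: "lyndon [A]"
  by (auto simp: lyndon_def Cons_eq_append_conv)

text \<open>A nonempty proper suffix disagrees with \<open>u\<close> in some letter, so it cannot be
  a prefix as well.\<close>

lemma lyndon_unbordered:
  assumes "lyndon u" "u = s @ y" "u = x @ s" "s \<noteq> []"
  shows "x = []"
proof (rule ccontr)
  assume "x \<noteq> []"
  then have "strict_less u s"
    using assms(1,3,4) unfolding lyndon_def by blast
  then obtain p q r where "u = p @ A # q" "s = p @ B # r"
    by (auto simp: strict_less_def)
  then show False
    using assms(2) by simp
qed

text \<open>Let \<open>g\<close> be a Lyndon prefix longer than the quasiperiod. The last occurrence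
  of the quasiperiod that starts inside \<open>g\<close> reaches the end of \<open>g\<close>. The
  part of \<open>g\<close> from there on is a prefix of the quasiperiod, hence of \<open>g\<close>,
  and so a border.\<close>

lemma not_quasiperiodic_if_unbounded_lyndon_prefixes:
  assumes "\<And>k. \<exists>g. is_prefix g w \<and> lyndon g \<and> k < length g"
  shows "\<not> quasiperiodic w"
proof
  assume "quasiperiodic w"
  then obtain q p where "p 0 = []" and "\<forall>n. 0 < int (length (p (Suc n))) - int (length (p n)) \<and>
      int (length (p (Suc n))) - int (length (p n)) \<le> int (length q) \<and> is_prefix (p n @ q) w"
    unfolding quasiperiodic_def quasiperiod_def by blast
  then have p: "p 0 = []" "length (p n) < length (p (Suc n))"
      "length (p (Suc n)) \<le> length (p n) + length q" "is_prefix (p n @ q) w" for n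
    by (auto dest: spec[of _ n])
  obtain g where g: "is_prefix g w" "lyndon g" "length q < length g"
    using assms by blast
  have "n \<le> length (p n)" for n
  proof (induction n)
    case (Suc n)
    then show ?case using p(2)[of n] by linarith
  qed simp
  \<comment> \<open>\<open>m\<close> is the first occurrence starting at or after the end of
    \<open>g\<close>; its predecessor covers the end.\<close>
  then obtain m where m: "length g \<le> length (p m)" "\<And>j. j < m \<Longrightarrow> \<not> length g \<le> length (p j)"
    using exists_least_iff[of "\<lambda>n. length g \<le> length (p n)"] by blast
  have "m \<noteq> 0"
    using m(1) p(1) g(3) by (cases m) auto
  then obtain k where k: "m = Suc k"
    using not0_implies_Suc by blast
  have len: "length (p k) < length g" "length g \<le> length (p k) + length q"
    using m(1) m(2)[of k] p(3)[of k] unfolding k by auto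
  have "is_prefix (p k) w"
    using p(4) is_prefix_appendD by blast
  then obtain s where s: "g = p k @ s"
    using is_prefix_comparable[OF _ g(1)] len(1) by fastforce
  obtain r where "p k @ q = g @ r"
    using is_prefix_comparable[OF g(1) p(4)[of k]] len(2) by auto
  then have "q = s @ r"
    using s by simp
  moreover obtain t where "g = q @ t"
    using is_prefix_comparable[OF _ g(1), of q] p(1) p(4)[of 0] g(3) by fastforce
  ultimately have "g = s @ (r @ t)"
    by simp
  from lyndon_unbordered[OF g(2) this s] have "p k = []"
    using s len(1) by auto
  then show False
    using len(2) g(3) by simp
qed

section \<open>Morphisms preserving Lyndon words\<close>

definition lyndon_morphism :: "morphism \<Rightarrow> bool" where
  "lyndon_morphism f \<longleftrightarrow> word_morphism f \<and> (\<forall>u. lyndon u \<longrightarrow> lyndon (f u))"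

lemma lyndon_morphism_id: "lyndon_morphism id"
  by (simp add: lyndon_morphism_def word_morphism_id)

lemma lyndon_morphism_comp:
  "lyndon_morphism f \<Longrightarrow> lyndon_morphism g \<Longrightarrow> lyndon_morphism (f \<circ> g)"
  by (simp add: lyndon_morphism_def word_morphism_comp)

lemma lyndon_morphism_funpow: "lyndon_morphism f \<Longrightarrow> lyndon_morphism (f ^^ n)"
  by (induction n) (auto intro: lyndon_morphism_id lyndon_morphism_comp)

lemma lyndon_morphism_A: "lyndon_morphism f \<Longrightarrow> \<exists>z. f [A] = A # z"
  using lyndon_A by (auto simp: lyndon_morphism_def lyndon_def)

text \<open>A suffix of \<open>f u\<close> starting with \<open>B\<close> exceeds \<open>f u\<close>
  in the first letter. Any other one is \<open>f s'\<close> for a suffix \<open>s'\<close> of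
  \<open>u\<close>, and beyond the common prefix of \<open>u\<close> and \<open>s'\<close> the
  comparison is \<open>mono\<close>. Its length condition holds because \<open>s'\<close> is shorter
  than \<open>u\<close>.\<close>

lemma lyndon_morphismI:
  assumes f: "word_morphism f" and A: "\<And>z. \<exists>y. f (A # z) = A # y"
    and split: "\<And>u x s. f u = x @ s \<Longrightarrow> s \<noteq> [] \<Longrightarrow>
      (\<exists>x' s'. u = x' @ s' \<and> x = f x' \<and> s = f s') \<or> (\<exists>s'. s = B # s')"
    and mono: "\<And>y z. length z < length y \<Longrightarrow> strict_less (f (A # y)) (f (B # z))"
  shows "lyndon_morphism f"
  unfolding lyndon_morphism_def
proof (intro conjI allI impI f)
  fix u assume u: "lyndon u"
  then obtain y where y: "f u = A # y"
    using A unfolding lyndon_def by metis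
  have "strict_less (f u) s" if xs: "f u = x @ s" "x \<noteq> []" "s \<noteq> []" for x s
    using split[OF xs(1,3)]
  proof
    assume "\<exists>s'. s = B # s'"
    then show ?thesis
      unfolding strict_less_def y by (metis append_Nil)
  next
    assume "\<exists>x' s'. u = x' @ s' \<and> x = f x' \<and> s = f s'"
    then obtain x' s' where eq: "u = x' @ s'" "x = f x'" "s = f s'"
      by blast
    then have "x' \<noteq> []" "s' \<noteq> []"
      using xs word_morphism_Nil[OF f] by auto
    then have "strict_less u s'"
      using u eq(1) by (auto simp: lyndon_def)
    then obtain p a b where pab: "u = p @ A # a" "s' = p @ B # b"
      by (auto simp: strict_less_def)
    have "length s' < length u"
      using eq(1) \<open>x' \<noteq> []\<close> by simp
    then have "strict_less (f (A # a)) (f (B # b))"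
      using mono pab by simp
    moreover have "f u = f p @ f (A # a)" "s = f p @ f (B # b)"
      using eq(3) pab word_morphism_append[OF f] by simp_all
    ultimately show ?thesis
      unfolding strict_less_def by (metis append.assoc)
  qed
  then show "lyndon (f u)"
    using y by (simp add: lyndon_def)
qed

text \<open>A cut of \<open>L\<^sub>a u\<close> falls between two letter images or inside an image
  \<open>AB\<close>; the latter leaves a suffix starting with \<open>B\<close>.\<close>

lemma lyndon_morphism_L\<^sub>a: "lyndon_morphism L\<^sub>a"
proof (rule lyndon_morphismI[OF word_morphism_L\<^sub>a])
  fix u x s assume "L\<^sub>a u = x @ s" "s \<noteq> []"
  then show "(\<exists>x' s'. u = x' @ s' \<and> x = L\<^sub>a x' \<and> s = L\<^sub>a s') \<or> (\<exists>s'. s = B # s')"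
  proof (induction u arbitrary: x)
    case (Cons c u)
    show ?case
    proof (cases x)
      case Nil
      then show ?thesis using Cons.prems by (intro disjI1 exI[of _ "[]"] exI[of _ "c # u"]) auto
    next
      case x: (Cons a y)
      show ?thesis
      proof (cases c)
        case A
        then have "L\<^sub>a u = y @ s" "a = A" using Cons.prems x by auto
        from Cons.IH[OF this(1) Cons.prems(2)] show ?thesis
          unfolding x A \<open>a = A\<close> by (metis append_Cons morph_simps(2))
      next
        case B
        show ?thesis
        proof (cases y)
          case Nil
          then show ?thesis using Cons.prems x B by auto
        next
          case y: (Cons b z)
          then have "L\<^sub>a u = z @ s" "a = A" "b = B" using Cons.prems x B by auto
          from Cons.IH[OF this(1) Cons.prems(2)] show ?thesis
            unfolding x y B \<open>a = A\<close> \<open>b = B\<close> by (metis append_Cons morph_simps(3))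
        qed
      qed
    qed
  qed simp
next
  fix y z :: "letter list" assume "length z < length y"
  \<comment> \<open>\<open>L\<^sub>a (A # y)\<close> starts with \<open>AA\<close> and
    \<open>L\<^sub>a (B # z)\<close> with \<open>AB\<close>. The second \<open>A\<close> comes from
    \<open>y\<close>, which is nonempty, being longer than \<open>z\<close>.\<close>
  then obtain c y' where "y = c # y'"
    by (cases y) auto
  then obtain t where "L\<^sub>a y = A # t"
    by (cases c) auto
  then show "strict_less (L\<^sub>a (A # y)) (L\<^sub>a (B # z))"
    unfolding strict_less_def by (intro exI[of _ "[A]"] exI) auto
qed simp

lemma lyndon_morphism_R\<^sub>b: "lyndon_morphism R\<^sub>b"
proof (rule lyndon_morphismI[OF word_morphism_R\<^sub>b])
  fix u x s assume "R\<^sub>b u = x @ s" "s \<noteq> []"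
  then show "(\<exists>x' s'. u = x' @ s' \<and> x = R\<^sub>b x' \<and> s = R\<^sub>b s') \<or> (\<exists>s'. s = B # s')"
  proof (induction u arbitrary: x)
    case (Cons c u)
    show ?case
    proof (cases x)
      case Nil
      then show ?thesis using Cons.prems by (intro disjI1 exI[of _ "[]"] exI[of _ "c # u"]) auto
    next
      case x: (Cons a y)
      show ?thesis
      proof (cases c)
        case B
        then have "R\<^sub>b u = y @ s" "a = B" using Cons.prems x by auto
        from Cons.IH[OF this(1) Cons.prems(2)] show ?thesis
          unfolding x B \<open>a = B\<close> by (metis append_Cons morph_simps(6))
      next
        case A
        show ?thesis
        proof (cases y)
          case Nil
          then show ?thesis using Cons.prems x A by auto
        next
          case y: (Cons b z)
          then have "R\<^sub>b u = z @ s" "a = A" "b = B" using Cons.prems x A by auto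
          from Cons.IH[OF this(1) Cons.prems(2)] show ?thesis
            unfolding x y A \<open>a = A\<close> \<open>b = B\<close> by (metis append_Cons morph_simps(5))
        qed
      qed
    qed
  qed simp
next
  fix y z :: "letter list"
  show "strict_less (R\<^sub>b (A # y)) (R\<^sub>b (B # z))"
    unfolding strict_less_def by (intro exI[of _ "[]"] exI) auto
qed simp

section \<open>Directive sequences\<close>

text \<open>For Lyndon morphisms each composition applied to \<open>A\<close> extends the previous
  one, so this amounts to convergence to \<open>w\<close>.\<close>

definition directs :: "(nat \<Rightarrow> morphism) \<Rightarrow> letter word \<Rightarrow> bool" where
  "directs h w \<longleftrightarrow> (\<forall>n. is_prefix (compose_upto h n [A]) w) \<and>
     (\<forall>k. \<exists>n. k \<le> length (compose_upto h n [A]))"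

text \<open>Each \<open>y n\<close> begins almost all \<open>x N\<close> and so fixes their first
  letters, although the \<open>x N\<close> need not extend one another.\<close>

lemma word_lim_if_eventually_extends:
  assumes "\<And>n. is_prefix (y n) w" "\<And>k. \<exists>n. k \<le> length (y n)"
    and ext: "\<And>n. \<exists>m. \<forall>N\<ge>m. \<exists>z. x N = y n @ z"
  shows "word_lim x w"
  unfolding word_lim_def
proof
  fix k
  obtain n where n: "k \<le> length (y n)"
    using assms(2) by blast
  obtain m where m: "\<forall>N\<ge>m. \<exists>z. x N = y n @ z"
    using ext by blast
  have "prefix k w = take k (prefix (length (y n)) w)"
    using n by (simp add: min_def)
  also have "\<dots> = take k (y n)"
    using assms(1) by (simp only: is_prefix_iff_prefix)
  finally have "k \<le> length (x N) \<and> take k (x N) = prefix k w" if "N \<ge> m" for N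
    using m that n by fastforce
  then show "\<exists>m. \<forall>N\<ge>m. k \<le> length (x N) \<and> take k (x N) = prefix k w"
    by blast
qed

lemma word_lim_is_prefix:
  assumes "word_lim x w" "\<forall>N\<ge>m. \<exists>z. x N = y @ z"
  shows "is_prefix y w"
proof -
  obtain K where K: "\<And>n. n \<ge> K \<Longrightarrow> take (length y) (x n) = prefix (length y) w"
    using assms(1) unfolding word_lim_def by blast
  obtain z where "x (max K m) = y @ z"
    using assms(2) by fastforce
  with K[of "max K m"] show ?thesis
    by (simp add: is_prefix_iff_prefix)
qed

lemma word_lim_unbounded: "word_lim x w \<Longrightarrow> \<exists>m\<ge>n. k \<le> length (x m)"
  unfolding word_lim_def by (metis nat_le_linear)

locale lyndon_sequence =
  fixes h :: "nat \<Rightarrow> morphism"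
  assumes lyndon: "i \<ge> 1 \<Longrightarrow> lyndon_morphism (h i)"
begin

lemma morphism: "word_morphism (compose_upto h n)"
  using lyndon word_morphism_compose_upto by (auto simp: lyndon_morphism_def)

lemma lyndon_compose: "lyndon (compose_upto h n [A])"
proof -
  have "lyndon_morphism (compose_upto h n)"
  proof (induction n)
    case (Suc n)
    then show ?case
      unfolding compose_upto.simps by (intro lyndon_morphism_comp lyndon) simp_all
  qed (unfold compose_upto.simps, rule lyndon_morphism_id)
  then show ?thesis
    using lyndon_A by (simp add: lyndon_morphism_def)
qed

lemma compose_Suc_A:
  obtains z where "h (Suc n) [A] = A # z"
    "compose_upto h (Suc n) [A] = compose_upto h n [A] @ compose_upto h n z"
proof -
  obtain z where z: "h (Suc n) [A] = A # z"
    using lyndon_morphism_A lyndon by (metis Suc_eq_plus1 le_add2)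
  then show ?thesis
    using that word_morphism_Cons[OF morphism[of n], of A z] by simp
qed

lemma compose_extends: "n \<le> m \<Longrightarrow> \<exists>z. compose_upto h m [A] = compose_upto h n [A] @ z"
proof (induction m rule: dec_induct)
  case (step m)
  then show ?case
    using compose_Suc_A[of m] by (metis append.assoc)
qed simp

lemma not_quasiperiodic: "directs h w \<Longrightarrow> \<not> quasiperiodic w"
  using not_quasiperiodic_if_unbounded_lyndon_prefixes lyndon_compose
  unfolding directs_def by (metis Suc_le_lessD)

lemma directs_iff_word_lim: "directs h w \<longleftrightarrow> word_lim (\<lambda>n. compose_upto h n [A]) w"
proof
  assume "directs h w"
  then show "word_lim (\<lambda>n. compose_upto h n [A]) w"
    using compose_extends by (intro word_lim_if_eventually_extends) (auto simp: directs_def)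
next
  assume lim: "word_lim (\<lambda>n. compose_upto h n [A]) w"
  have "is_prefix (compose_upto h n [A]) w" for n
    using word_lim_is_prefix[OF lim] compose_extends by blast
  then show "directs h w"
    using word_lim_unbounded[OF lim] unfolding directs_def by blast
qed

text \<open>Whenever \<open>h m [A]\<close> has a second letter, the composition grows by a nonempty
  word.\<close>

lemma unbounded:
  assumes "\<And>n. \<exists>m>n. 2 \<le> length (h m [A])"
  shows "\<exists>n. k \<le> length (compose_upto h n [A])"
proof (induction k)
  case (Suc k)
  then obtain n where n: "k \<le> length (compose_upto h n [A])"
    by blast
  obtain m where m: "m > n" "2 \<le> length (h m [A])"
    using assms by blast
  obtain m' where m': "m = Suc m'" "n \<le> m'"
    using m(1) by (cases m) auto
  obtain z where z: "h m [A] = A # z"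
      "compose_upto h m [A] = compose_upto h m' [A] @ compose_upto h m' z"
    using compose_Suc_A[of m'] m' by blast
  have "1 \<le> length (compose_upto h m' z)"
    using m(2) z(1) word_morphism_length[OF morphism, of z m'] by simp
  moreover have "length (compose_upto h n [A]) \<le> length (compose_upto h m' [A])"
    using compose_extends[OF m'(2)] by auto
  ultimately show ?case
    using n z(2) by (intro exI[of _ m]) simp
qed simp

text \<open>Exchanging the letters turns \<open>L\<^sub>b, R\<^sub>a\<close> into \<open>L\<^sub>a, R\<^sub>b\<close> but the letter \<open>a\<close>, to which the
  compositions are applied, into \<open>b\<close>; the resulting words need not be prefixes of each other.\<close>

lemma compose_B_extends:
  assumes B: "\<And>i. i \<ge> 1 \<Longrightarrow> h i [B] = [B] \<or> (\<exists>z. h i [B] = A # z)"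
    and inf: "\<And>n. \<exists>m>n. \<exists>z. h m [B] = A # z"
  shows "\<exists>m. \<forall>N\<ge>m. \<exists>z. compose_upto h N [B] = compose_upto h n [A] @ z"
proof -
  \<comment> \<open>An image of \<open>B\<close> starting with \<open>A\<close> leads back to a
    composition applied to \<open>A\<close>; where \<open>B\<close> is fixed instead, the
    composition applied to \<open>B\<close> stays the same.\<close>
  have A: "\<exists>y. compose_upto h (Suc N) [B] = compose_upto h n [A] @ y"
    if "n \<le> N" "h (Suc N) [B] = A # z" for N z
    using that(2) word_morphism_Cons[OF morphism[of N], of A z] compose_extends[OF that(1)] by auto
  obtain m z where m: "m > n" "h m [B] = A # z"
    using inf by blast
  have "\<exists>z. compose_upto h N [B] = compose_upto h n [A] @ z" if "N \<ge> m" for N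
    using that
  proof (induction N rule: dec_induct)
    case base
    then show ?case
      using m A[of "m - 1" z] by (cases m) auto
  next
    case (step N)
    then show ?case
      using m(1) B[of "Suc N"] A[of N] by auto
  qed
  then show ?thesis
    by blast
qed

lemma directs_iff_word_lim_B:
  assumes "\<And>n. \<exists>m>n. 2 \<le> length (h m [A])"
    and "\<And>i. i \<ge> 1 \<Longrightarrow> h i [B] = [B] \<or> (\<exists>z. h i [B] = A # z)"
    and "\<And>n. \<exists>m>n. \<exists>z. h m [B] = A # z"
  shows "directs h w \<longleftrightarrow> word_lim (\<lambda>n. compose_upto h n [B]) w"
proof
  assume "directs h w"
  then show "word_lim (\<lambda>n. compose_upto h n [B]) w"
    using compose_B_extends[OF assms(2,3)]
    by (intro word_lim_if_eventually_extends[of "\<lambda>n. compose_upto h n [A]"])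
      (auto simp: directs_def)
next
  assume lim: "word_lim (\<lambda>n. compose_upto h n [B]) w"
  have "is_prefix (compose_upto h n [A]) w" for n
    using word_lim_is_prefix[OF lim] compose_B_extends[OF assms(2,3)] by blast
  then show "directs h w"
    using unbounded[OF assms(1)] by (auto simp: directs_def)
qed

text \<open>After \<open>n\<close> desubstitutions of \<open>x 0\<close> the remaining word
  \<open>x n\<close> starts with \<open>A\<close>, so the composition applied to \<open>A\<close> is
  a prefix of \<open>x 0\<close>.\<close>

lemma directsI:
  assumes "\<And>n. image_word (h (Suc n)) (x (Suc n)) (x n)" "\<And>n. x n 0 = A"
    and "\<And>n. \<exists>m>n. 2 \<le> length (h m [A])"
  shows "directs h (x 0)"
proof -
  have "image_word (compose_upto h n) (x n) (x 0)" for n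
  proof (induction n)
    case (Suc n)
    then show ?case
      unfolding compose_upto.simps using assms(1) by (rule image_word_comp)
  qed (simp add: image_word_def)
  moreover have "is_prefix [A] (x n)" for n
    using assms(2) by (simp add: is_prefix_iff_nth)
  ultimately show ?thesis
    using image_wordD unbounded[OF assms(3)] unfolding directs_def by blast
qed

end

section \<open>Sequences over \<open>L\<^sub>a\<close> and \<open>R\<^sub>b\<close>\<close>

lemma compose_upto_eventually_constant:
  "(\<And>i. i > M \<Longrightarrow> f i = g) \<Longrightarrow> compose_upto f (M + k) = compose_upto f M \<circ> g ^^ k"
  by (induction k) (auto simp: funpow_Suc_right simp del: funpow.simps)

lemma image_word_funpow:
  assumes "\<And>n. image_word (f (Suc n)) (x (Suc n)) (x n)" "\<And>i. i > M \<Longrightarrow> f i = g"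
  shows "image_word (g ^^ k) (x (M + k)) (x M)"
proof (induction k)
  case (Suc k)
  have "image_word g (x (M + Suc k)) (x (M + k))"
    using assms(1)[of "M + k"] assms(2)[of "Suc (M + k)"] by simp
  with Suc show ?case
    unfolding funpow_Suc_right by (rule image_word_comp)
qed (simp add: image_word_def)

lemma lyndon_sequence_letters: "\<forall>i\<ge>1. f i \<in> {L\<^sub>a, R\<^sub>b} \<Longrightarrow> lyndon_sequence f"
  using lyndon_morphism_L\<^sub>a lyndon_morphism_R\<^sub>b by unfold_locales auto

text \<open>\<open>R\<^sub>b\<close> lengthens \<open>A\<close>, and \<open>L\<^sub>a\<close> turns
  \<open>B\<close> into a word starting with \<open>A\<close>. If both recur, compositions applied
  to \<open>A\<close> and to \<open>B\<close> have the same limit.\<close>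

lemma letter_sequence:
  assumes f: "\<forall>i\<ge>1. f i \<in> {L\<^sub>a, R\<^sub>b}" and inf: "\<And>n. \<exists>m>n. f m = L\<^sub>a" "\<And>n. \<exists>m>n. f m = R\<^sub>b"
  shows letter_sequence_inf_A: "\<exists>m>n. 2 \<le> length (f m [A])"
    and letter_sequence_directs_B: "directs f w \<longleftrightarrow> word_lim (\<lambda>n. compose_upto f n [B]) w"
proof -
  show A: "\<exists>m>n. 2 \<le> length (f m [A])" for n
  proof -
    obtain m where "m > n" "f m = R\<^sub>b"
      using inf(2) by blast
    then show ?thesis
      by (intro exI[of _ m]) simp
  qed
  have B: "f i [B] = [B] \<or> (\<exists>z. f i [B] = A # z)" if "i \<ge> 1" for i
    using f[rule_format, OF that] by auto
  have "\<exists>m>n. \<exists>z. f m [B] = A # z" for n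
  proof -
    obtain m where "m > n" "f m = L\<^sub>a"
      using inf(1) by blast
    then show ?thesis
      by (intro exI[of _ m]) simp
  qed
  with A B show "directs f w \<longleftrightarrow> word_lim (\<lambda>n. compose_upto f n [B]) w"
    by (rule lyndon_sequence.directs_iff_word_lim_B[OF lyndon_sequence_letters[OF f]])
qed

text \<open>A tail of \<open>R\<^sub>b\<close> fixes \<open>B\<close> and stops the growth, and a
  tail of \<open>L\<^sub>a\<close> gives a periodic limit. Otherwise both recur, and the
  compositions applied to \<open>A\<close> are Lyndon prefixes of \<open>w\<close>.\<close>

lemma letter_limit_B_not_quasiperiodic:
  assumes f: "\<forall>i\<ge>1. f i \<in> {L\<^sub>a, R\<^sub>b}" and lim: "word_lim (\<lambda>n. compose_upto f n [B]) w"
    and per: "\<not> ultimately_periodic w"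
  shows "\<not> quasiperiodic w"
proof -
  interpret lyndon_sequence f
    by (rule lyndon_sequence_letters[OF f])
  have infL: "\<exists>m>n. f m = L\<^sub>a" for n
  proof (rule ccontr)
    assume "\<not> (\<exists>m>n. f m = L\<^sub>a)"
    then have "f i = R\<^sub>b" if "i > n" for i
      using f[rule_format, of i] that \<open>\<not> (\<exists>m>n. f m = L\<^sub>a)\<close> by auto
    then have "compose_upto f (n + k) [B] = compose_upto f n [B]" for k
      by (subst compose_upto_eventually_constant) auto
    then show False
      using word_lim_unbounded[OF lim, of n "Suc (length (compose_upto f n [B]))"]
      by (metis le_Suc_ex not_less_eq_eq order_refl)
  qed
  have infR: "\<exists>m>n. f m = R\<^sub>b" for n
  proof (rule ccontr)
    assume "\<not> (\<exists>m>n. f m = R\<^sub>b)"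
    then have "f i = L\<^sub>a" if "i > n" for i
      using f[rule_format, of i] that \<open>\<not> (\<exists>m>n. f m = R\<^sub>b)\<close> by auto
    then have eq: "compose_upto f (n + k) = compose_upto f n \<circ> L\<^sub>a ^^ k" for k
      by (rule compose_upto_eventually_constant)
    let ?v = "compose_upto f n [A]"
    have pow: "compose_upto f n (replicate k A) = concat (replicate k ?v)" for k
    proof (induction k)
      case (Suc k)
      then show ?case
        using word_morphism_Cons[OF morphism[of n], of A "replicate k A"] by simp
    qed (simp add: word_morphism_Nil[OF morphism])
    have LB: "(L\<^sub>a ^^ k) [B] = replicate k A @ [B]" for k
      using L\<^sub>a_funpow[of k 0] by simp
    \<comment> \<open>\<open>L\<^sub>a ^^ k\<close> puts \<open>k\<close> letters \<open>A\<close>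
      before \<open>B\<close>, and each of them becomes a copy of \<open>?v\<close>.\<close>
    have ext: "\<exists>z. compose_upto f N [B] = concat (replicate k ?v) @ z" if N: "N \<ge> n + k" for N k
    proof -
      obtain j where "N = n + (k + j)"
        using N le_Suc_ex by (metis add.assoc)
      then show ?thesis
        by (simp add: eq LB replicate_add word_morphism_append[OF morphism] pow)
    qed
    have "is_prefix ([] @ concat (replicate k ?v)) w" for k
      using word_lim_is_prefix[OF lim, of "n + k"] ext by simp
    moreover have "?v \<noteq> []"
      using word_morphism_length[OF morphism, of "[A]" n] by auto
    ultimately show False
      using ultimately_periodicI per by blast
  qed
  show ?thesis
    using not_quasiperiodic lim letter_sequence_directs_B[OF f infL infR] by blast
qed

text \<open>Preimages are chosen one at a time; the bounds on powers make both morphisms recur. The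
  limit from \<open>B\<close> is the one that the exchange of letters requires.\<close>

lemma nonqp_sturmian_letter_decomposition:
  assumes "nonqp_sturmian w"
  obtains f where "\<forall>i\<ge>1. f i \<in> {L\<^sub>a, R\<^sub>b}" "word_lim (\<lambda>n. compose_upto f n [A]) w"
    "word_lim (\<lambda>n. compose_upto f n [B]) w"
proof -
  have "\<exists>x. \<forall>n. (nonqp_sturmian (x n) \<and> (n = 0 \<longrightarrow> x n = w)) \<and>
      (\<exists>g\<in>{L\<^sub>a, R\<^sub>b}. image_word g (x (Suc n)) (x n))"
  proof (rule dependent_nat_choice)
    fix x and n :: nat assume "nonqp_sturmian x \<and> (n = 0 \<longrightarrow> x = w)"
    then obtain y where "nonqp_sturmian y" "image_word L\<^sub>a y x \<or> image_word R\<^sub>b y x"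
      using nonqp_sturmian_L\<^sub>a_preimage[of x] nonqp_sturmian_R\<^sub>b_preimage[of x] by metis
    then show "\<exists>y. (nonqp_sturmian y \<and> (Suc n = 0 \<longrightarrow> y = w)) \<and> (\<exists>g\<in>{L\<^sub>a, R\<^sub>b}. image_word g y x)"
      by auto
  qed (use assms in auto)
  then obtain x where x: "x 0 = w" "\<And>n. nonqp_sturmian (x n)"
      "\<forall>n. \<exists>g. g \<in> {L\<^sub>a, R\<^sub>b} \<and> image_word g (x (Suc n)) (x n)"
    by (metis (no_types, lifting))
  obtain g where g: "\<And>n. g n \<in> {L\<^sub>a, R\<^sub>b}" "\<And>n. image_word (g n) (x (Suc n)) (x n)"
    using choice[OF x(3)] by auto
  define f where "f i = g (i - 1)" for i
  have f: "\<forall>i\<ge>1. f i \<in> {L\<^sub>a, R\<^sub>b}" and im: "image_word (f (Suc n)) (x (Suc n)) (x n)" for n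
    using g by (auto simp: f_def)
  interpret lyndon_sequence f
    by (rule lyndon_sequence_letters[OF f])
  have res: "sturmian (x n)" "x n 0 = A" for n
    using x(2) by (auto simp: nonqp_sturmian_def)
  have infL: "\<exists>m>n. f m = L\<^sub>a" for n
  proof (rule ccontr)
    assume "\<not> (\<exists>m>n. f m = L\<^sub>a)"
    then have "f i = R\<^sub>b" if "i > n" for i
      using f[rule_format, of i] that \<open>\<not> (\<exists>m>n. f m = L\<^sub>a)\<close> by auto
    then have "image_word (R\<^sub>b ^^ k) (x (n + k)) (x n)" for k
      by (rule image_word_funpow[of f x, OF im])
    then show False
      using R\<^sub>b_power_bounded[OF res(1)[of n]] res(2) by (metis Suc_n_not_le_n)
  qed
  have infR: "\<exists>m>n. f m = R\<^sub>b" for n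
  proof (rule ccontr)
    assume "\<not> (\<exists>m>n. f m = R\<^sub>b)"
    then have "f i = L\<^sub>a" if "i > n" for i
      using f[rule_format, of i] that \<open>\<not> (\<exists>m>n. f m = R\<^sub>b)\<close> by auto
    then have "image_word (L\<^sub>a ^^ k) (x (n + k)) (x n)" for k
      by (rule image_word_funpow[of f x, OF im])
    then show False
      using L\<^sub>a_power_bounded[OF res(1)[of n]] res(1) by (metis Suc_n_not_le_n)
  qed
  have "directs f w"
    using directsI[of x, OF im res(2) letter_sequence_inf_A[OF f infL infR]] x(1) by simp
  then show ?thesis
    using that[OF f] directs_iff_word_lim letter_sequence_directs_B[OF f infL infR] by blast
qed

section \<open>Sequences of blocks\<close>

abbreviation blocks :: "(nat \<Rightarrow> nat) \<Rightarrow> nat \<Rightarrow> morphism" where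
  "blocks d i \<equiv> (L\<^sub>a ^^ d (2 * i - 1)) \<circ> (R\<^sub>b ^^ d (2 * i))"

lemma lyndon_sequence_blocks: "lyndon_sequence (blocks d)"
  by unfold_locales (intro lyndon_morphism_comp lyndon_morphism_funpow
      lyndon_morphism_L\<^sub>a lyndon_morphism_R\<^sub>b)

lemma blocks_B: "blocks d i [B] = replicate (d (2 * i - 1)) A @ [B]"
  using L\<^sub>a_funpow[of "d (2 * i - 1)" 0] by simp

lemma blocks_inf_A:
  assumes "\<forall>k\<ge>2. d k \<ge> (1::nat)"
  shows "\<exists>m>n. 2 \<le> length (blocks d m [A])"
proof (intro exI conjI)
  have "length ((R\<^sub>b ^^ d (2 * Suc n)) [A]) \<le> length (blocks d (Suc n) [A])" 
    using word_morphism_length[OF word_morphism_funpow[OF word_morphism_L\<^sub>a]] by simp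
  then show "2 \<le> length (blocks d (Suc n) [A])"
    using assms[rule_format, of "2 * Suc n"] by (simp add: R\<^sub>b_funpow)
qed simp

lemma blocks_step_B: "blocks d i [B] = [B] \<or> (\<exists>z. blocks d i [B] = A # z)"
  unfolding blocks_B by (cases "d (2 * i - 1)") auto

lemma blocks_inf_B:
  assumes "\<forall>k\<ge>2. d k \<ge> (1::nat)"
  shows "\<exists>m>n. \<exists>z. blocks d m [B] = A # z"
proof -
  \<comment> \<open>\<open>d 1\<close> may vanish, so the first block is avoided by taking
    \<open>Suc (Suc n)\<close>.\<close>
  have "d (2 * Suc (Suc n) - 1) \<ge> 1"
    using assms by simp
  then show ?thesis
    unfolding blocks_B by (intro exI[of _ "Suc (Suc n)"]) (cases "d (2 * Suc (Suc n) - 1)"; simp)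
qed

lemma nonqp_sturmian_block_decomposition:
  assumes "nonqp_sturmian w"
  obtains d where "\<forall>k\<ge>2. d k \<ge> (1::nat)" "directs (blocks d) w"
proof -
  \<comment> \<open>The factor \<open>AA\<close> in every word after the first makes all exponents
    of \<open>L\<^sub>a\<close> but the first positive.\<close>
  have "\<exists>x. \<forall>n. (nonqp_sturmian (x n) \<and> (n = 0 \<longrightarrow> x n = w) \<and> (n > 0 \<longrightarrow> has_AA (x n))) \<and>
      (\<exists>a b. b \<ge> 1 \<and> (n > 0 \<longrightarrow> a \<ge> 1) \<and> image_word (L\<^sub>a ^^ a \<circ> R\<^sub>b ^^ b) (x (Suc n)) (x n))"
  proof (rule dependent_nat_choice)
    fix x and n :: nat
    assume x: "nonqp_sturmian x \<and> (n = 0 \<longrightarrow> x = w) \<and> (n > 0 \<longrightarrow> has_AA x)"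
    then obtain v a b where "nonqp_sturmian v" "has_AA v" "has_AA x \<Longrightarrow> a \<ge> 1" "b \<ge> 1"
        "image_word (L\<^sub>a ^^ a \<circ> R\<^sub>b ^^ b) v x"
      using nonqp_sturmian_block_preimage[of x] by blast
    with x show "\<exists>y. (nonqp_sturmian y \<and> (Suc n = 0 \<longrightarrow> y = w) \<and> (Suc n > 0 \<longrightarrow> has_AA y)) \<and>
        (\<exists>a b. b \<ge> 1 \<and> (n > 0 \<longrightarrow> a \<ge> 1) \<and> image_word (L\<^sub>a ^^ a \<circ> R\<^sub>b ^^ b) y x)"
      by blast
  qed (use assms in auto)
  then obtain x where x: "x 0 = w" "\<And>n. nonqp_sturmian (x n)" "\<forall>n. \<exists>a b. b \<ge> 1 \<and> (n > 0 \<longrightarrow> a \<ge> 1) \<and>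
      image_word (L\<^sub>a ^^ a \<circ> R\<^sub>b ^^ b) (x (Suc n)) (x n)"
    by (metis (no_types, lifting))
  obtain a where a: "\<forall>n. \<exists>b. b \<ge> 1 \<and> (n > 0 \<longrightarrow> a n \<ge> 1) \<and>
      image_word (L\<^sub>a ^^ a n \<circ> R\<^sub>b ^^ b) (x (Suc n)) (x n)"
    using choice[OF x(3)] by auto
  obtain b where b: "\<And>n. b n \<ge> 1" "\<And>n. n > 0 \<Longrightarrow> a n \<ge> 1"
      "\<And>n. image_word (L\<^sub>a ^^ a n \<circ> R\<^sub>b ^^ b n) (x (Suc n)) (x n)"
    using choice[OF a] by auto
  \<comment> \<open>Block \<open>Suc n\<close> reads the indices \<open>2 * n + 1\<close> and
    \<open>2 * n + 2\<close>, where \<open>a n\<close> and \<open>b n\<close> must stand.\<close>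
  define d where "d k = (if odd k then a (k div 2) else b (k div 2 - 1))" for k
  have d: "\<forall>k\<ge>2. d k \<ge> 1"
    using b(1,2) by (auto simp: d_def)
  have "image_word (blocks d (Suc n)) (x (Suc n)) (x n)" for n
    using b(3)[of n] by (simp add: d_def)
  then have "directs (blocks d) w"
    using lyndon_sequence.directsI[OF lyndon_sequence_blocks, of d x] blocks_inf_A[OF d] x(1,2)
    by (auto simp: nonqp_sturmian_def)
  then show ?thesis
    using that d by blast
qed

section \<open>Exchange of the letters\<close>

definition flip :: "letter \<Rightarrow> letter" where
  "flip c = (case c of A \<Rightarrow> B | B \<Rightarrow> A)"

lemma flip_simps [simp]: "flip A = B" "flip B = A" "flip (flip c) = c" "flip \<circ> flip = id"
  by (auto simp: flip_def fun_eq_iff split: letter.splits)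

lemma flip_eq_iff [simp]: "flip c = flip d \<longleftrightarrow> c = d"
  by (metis flip_simps(3))

lemma flip_flip_comp [simp]: "flip \<circ> (flip \<circ> w) = w"
  by (simp add: fun_eq_iff)

definition flip_morphism :: "morphism \<Rightarrow> morphism" where
  "flip_morphism f = map flip \<circ> f \<circ> map flip"

lemma flip_morphism_id: "flip_morphism id = id"
  and flip_morphism_comp: "flip_morphism (f \<circ> g) = flip_morphism f \<circ> flip_morphism g"
  and flip_morphism_flip [simp]: "flip_morphism (flip_morphism f) = f"
  by (simp_all add: flip_morphism_def fun_eq_iff)

lemma flip_morphism_funpow: "flip_morphism (f ^^ n) = flip_morphism f ^^ n"
  by (induction n) (simp_all only: funpow.simps flip_morphism_id flip_morphism_comp)

lemma flip_morphism_compose_upto: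
  "flip_morphism (compose_upto f n) = compose_upto (\<lambda>i. flip_morphism (f i)) n"
  by (induction n) (simp_all only: compose_upto.simps flip_morphism_id flip_morphism_comp)

lemma flip_morphism_morph:
  "flip_morphism (morph u v) = morph (map flip v) (map flip u)"
  by (auto simp: flip_morphism_def morph_def fun_eq_iff map_concat comp_def flip_def
      split: letter.splits intro!: arg_cong[where f = concat])

lemma flip_morphism_letters [simp]:
  "flip_morphism L\<^sub>a = L\<^sub>b" "flip_morphism R\<^sub>b = R\<^sub>a" "flip_morphism L\<^sub>b = L\<^sub>a" "flip_morphism R\<^sub>a = R\<^sub>b"
  by (simp_all add: L\<^sub>a_def L\<^sub>b_def R\<^sub>a_def R\<^sub>b_def flip_morphism_morph)

lemma is_prefix_flip: "is_prefix (map flip u) (flip \<circ> w) \<longleftrightarrow> is_prefix u w"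
  by (simp add: is_prefix_iff_nth)

lemma word_lim_flip: "word_lim (\<lambda>n. map flip (x n)) (flip \<circ> w) \<longleftrightarrow> word_lim x w"
proof -
  have "take k (map flip y) = prefix k (flip \<circ> w) \<longleftrightarrow> take k y = prefix k w" for k y
  proof -
    have "prefix k (flip \<circ> w) = map flip (prefix k w)"
      by (simp add: subsequence_def)
    moreover have "inj flip"
      by (simp add: inj_def)
    ultimately show ?thesis
      by (simp add: take_map inj_map_eq_map)
  qed
  then show ?thesis
    by (simp add: word_lim_def)
qed

lemma quasiperiodic_flipD: "quasiperiodic w \<Longrightarrow> quasiperiodic (flip \<circ> w)"
proof -
  assume "quasiperiodic w"
  then obtain u p where "p 0 = []" and "\<forall>n. 0 < int (length (p (Suc n))) - int (length (p n)) \<and>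
      int (length (p (Suc n))) - int (length (p n)) \<le> int (length u) \<and> is_prefix (p n @ u) w"
    unfolding quasiperiodic_def quasiperiod_def by blast
  then have "quasiperiod (map flip u) (flip \<circ> w)"
    unfolding quasiperiod_def using is_prefix_flip
    by (intro exI[of _ "\<lambda>n. map flip (p n)"]) (simp flip: map_append)
  then show ?thesis
    unfolding quasiperiodic_def by blast
qed

lemma quasiperiodic_flip: "quasiperiodic (flip \<circ> w) \<longleftrightarrow> quasiperiodic w"
  using quasiperiodic_flipD[of w] quasiperiodic_flipD[of "flip \<circ> w"] by auto

lemma sturmian_flip:
  assumes "sturmian w"
  shows "sturmian (flip \<circ> w)"
proof -
  have factor: "factor (map flip u) w" if "factor u (flip \<circ> w)" for u
    using that is_prefix_flip[of _ "flip \<circ> w"] unfolding factor_iff by (metis flip_flip_comp map_append)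
  have count: "count_list (map flip u) A = count_list u B" for u
    by (induction u) (auto simp: flip_def split: letter.splits)
  have "balanced (flip \<circ> w)"
    unfolding balanced_def
  proof (intro allI impI, elim conjE)
    fix u v assume uv: "factor u (flip \<circ> w)" "factor v (flip \<circ> w)" "length u = length v"
    then have "\<bar>int (count_list (map flip u) A) - int (count_list (map flip v) A)\<bar> \<le> 1"
      using assms factor[OF uv(1)] factor[OF uv(2)] unfolding sturmian_def balanced_def
      by (metis length_map)
    \<comment> \<open>For words of equal length the counts of \<open>B\<close> differ by as much as
      the counts of \<open>A\<close>.\<close>
    then show "\<bar>int (count_list u A) - int (count_list v A)\<bar> \<le> 1"
      using uv(3) count_list_length[of u] count_list_length[of v] unfolding count by linarith
  qed
  moreover have "ultimately_periodic w" if "ultimately_periodic (flip \<circ> w)"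
  proof -
    obtain u v where uv: "v \<noteq> []" "flip \<circ> w = u \<frown> v\<^sup>\<omega>"
      using \<open>ultimately_periodic (flip \<circ> w)\<close> unfolding ultimately_periodic_def by blast
    have "w = flip \<circ> (u \<frown> v\<^sup>\<omega>)"
      using uv(2) flip_flip_comp by metis
    also have "\<dots> = map flip u \<frown> (map flip v)\<^sup>\<omega>"
      using uv(1) by (simp add: fun_eq_iff conc_def)
    finally show ?thesis
      using uv(1) unfolding ultimately_periodic_def by (metis map_is_Nil_conv)
  qed
  ultimately show ?thesis
    using assms by (auto simp: sturmian_def)
qed

text \<open>Conjugation by the exchange also acts on the argument: compositions applied to
  \<open>A\<close> become compositions applied to \<open>B\<close>.\<close>

lemma word_lim_compose_flip:
  "word_lim (\<lambda>n. compose_upto f n [A]) w \<longleftrightarrow>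
   word_lim (\<lambda>n. compose_upto (\<lambda>i. flip_morphism (f i)) n [B]) (flip \<circ> w)"
proof -
  have "compose_upto (\<lambda>i. flip_morphism (f i)) n [B] = map flip (compose_upto f n [A])" for n
    unfolding flip_morphism_compose_upto[symmetric] by (simp add: flip_morphism_def)
  then show ?thesis
    by (simp add: word_lim_flip)
qed

lemma infinitely_decomposed_flip:
  "infinitely_decomposed {L\<^sub>b, R\<^sub>a} w \<longleftrightarrow>
   (\<exists>f. (\<forall>i\<ge>1. f i \<in> {L\<^sub>a, R\<^sub>b}) \<and> word_lim (\<lambda>n. compose_upto f n [B]) (flip \<circ> w))"
  (is "_ \<longleftrightarrow> ?r")
proof
  assume "infinitely_decomposed {L\<^sub>b, R\<^sub>a} w"
  then obtain f where f: "\<forall>i\<ge>1. f i \<in> {L\<^sub>b, R\<^sub>a}" "word_lim (\<lambda>n. compose_upto f n [A]) w"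
    by (auto simp: infinitely_decomposed_def)
  show ?r
  proof (intro exI conjI)
    show "\<forall>i\<ge>1. flip_morphism (f i) \<in> {L\<^sub>a, R\<^sub>b}"
      using f(1) by fastforce
  qed (use f(2) word_lim_compose_flip in blast)
next
  assume ?r
  then obtain f where f: "\<forall>i\<ge>1. f i \<in> {L\<^sub>a, R\<^sub>b}" "word_lim (\<lambda>n. compose_upto f n [B]) (flip \<circ> w)"
    by blast
  have "\<forall>i\<ge>1. flip_morphism (f i) \<in> {L\<^sub>b, R\<^sub>a}"
    using f(1) by fastforce
  moreover have "word_lim (\<lambda>n. compose_upto (\<lambda>i. flip_morphism (f i)) n [A]) w"
    using f(2) word_lim_compose_flip[of "\<lambda>i. flip_morphism (f i)" w] by simp
  ultimately show "infinitely_decomposed {L\<^sub>b, R\<^sub>a} w"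
    unfolding infinitely_decomposed_def by (intro exI[of _ "\<lambda>i. flip_morphism (f i)"]) blast
qed

lemma block_word_flip:
  "word_lim (block_word L\<^sub>b R\<^sub>a d) w \<longleftrightarrow> word_lim (\<lambda>n. compose_upto (blocks d) n [B]) (flip \<circ> w)"
  unfolding block_word_def[abs_def] word_lim_compose_flip flip_morphism_comp flip_morphism_funpow
  by simp

section \<open>Both characterizations\<close>

theorem theorem5p6:
  fixes w :: "letter word"
  assumes "sturmian w"
  shows "(\<not> quasiperiodic w \<longleftrightarrow>
            infinitely_decomposed {L\<^sub>a, R\<^sub>b} w \<or> infinitely_decomposed {L\<^sub>b, R\<^sub>a} w) \<and>
         (\<not> quasiperiodic w \<longleftrightarrow>
            (\<exists>d :: nat \<Rightarrow> nat. d 1 \<ge> 0 \<and> (\<forall>k\<ge>2. d k \<ge> 1) \<and>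
               (word_lim (block_word L\<^sub>a R\<^sub>b d) w \<or> word_lim (block_word L\<^sub>b R\<^sub>a d) w)))"
proof -
  note seq = lyndon_sequence_letters and bseq = lyndon_sequence_blocks
  have flip_sturmian: "sturmian (flip \<circ> w)"
    by (rule sturmian_flip[OF assms])
  have bl: "directs (blocks d) v \<longleftrightarrow> word_lim (block_word L\<^sub>a R\<^sub>b d) v" for d v
    unfolding block_word_def[abs_def] by (rule lyndon_sequence.directs_iff_word_lim[OF bseq])
  \<comment> \<open>The positive exponents make both morphisms recur, so limits from
    \<open>A\<close> and from \<open>B\<close> agree.\<close>
  have bl_flip: "directs (blocks d) (flip \<circ> w) \<longleftrightarrow> word_lim (block_word L\<^sub>b R\<^sub>a d) w"
    if "\<forall>k\<ge>2. d k \<ge> 1" for d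
    unfolding block_word_flip
    by (rule lyndon_sequence.directs_iff_word_lim_B[OF bseq
          blocks_inf_A[OF that] blocks_step_B blocks_inf_B[OF that]])
  have 1: "\<not> quasiperiodic w" if "infinitely_decomposed {L\<^sub>a, R\<^sub>b} w"
    using that lyndon_sequence.not_quasiperiodic[OF seq] lyndon_sequence.directs_iff_word_lim[OF seq]
    unfolding infinitely_decomposed_def by blast
  \<comment> \<open>Aperiodicity enters here, since compositions applied to \<open>B\<close> can
    also converge to a periodic word.\<close>
  have 2: "\<not> quasiperiodic w" if "infinitely_decomposed {L\<^sub>b, R\<^sub>a} w"
    using that letter_limit_B_not_quasiperiodic flip_sturmian quasiperiodic_flip
    unfolding infinitely_decomposed_flip sturmian_def by blast
  have 3: "\<not> quasiperiodic w" if "\<forall>k\<ge>2. d k \<ge> 1"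
    "word_lim (block_word L\<^sub>a R\<^sub>b d) w \<or> word_lim (block_word L\<^sub>b R\<^sub>a d) w" for d
    using that(2) lyndon_sequence.not_quasiperiodic[OF bseq] bl bl_flip[OF that(1)]
      quasiperiodic_flip by blast
  have 4: "(infinitely_decomposed {L\<^sub>a, R\<^sub>b} w \<or> infinitely_decomposed {L\<^sub>b, R\<^sub>a} w) \<and>
      (\<exists>d. (\<forall>k\<ge>2. d k \<ge> 1) \<and>
        (word_lim (block_word L\<^sub>a R\<^sub>b d) w \<or> word_lim (block_word L\<^sub>b R\<^sub>a d) w))"
    if "\<not> quasiperiodic w"
  \<comment> \<open>The first letter of \<open>w\<close> selects the pair of morphisms;
    \<open>B\<close> is reduced to \<open>A\<close> by the exchange.\<close>
  proof (cases "w 0")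
    case A
    then have res: "nonqp_sturmian w"
      using assms that by (simp add: nonqp_sturmian_def)
    obtain f where "\<forall>i\<ge>1. f i \<in> {L\<^sub>a, R\<^sub>b}" "word_lim (\<lambda>n. compose_upto f n [A]) w"
      using nonqp_sturmian_letter_decomposition[OF res] by blast
    moreover obtain d where "\<forall>k\<ge>2. d k \<ge> 1" "directs (blocks d) w"
      using nonqp_sturmian_block_decomposition[OF res] by blast
    ultimately show ?thesis
      unfolding infinitely_decomposed_def using bl by blast
  next
    case B
    then have res: "nonqp_sturmian (flip \<circ> w)"
      using flip_sturmian that quasiperiodic_flip by (simp add: nonqp_sturmian_def)
    obtain f where "\<forall>i\<ge>1. f i \<in> {L\<^sub>a, R\<^sub>b}" "word_lim (\<lambda>n. compose_upto f n [B]) (flip \<circ> w)"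
      using nonqp_sturmian_letter_decomposition[OF res] by blast
    moreover obtain d where "\<forall>k\<ge>2. d k \<ge> 1" "directs (blocks d) (flip \<circ> w)"
      using nonqp_sturmian_block_decomposition[OF res] by blast
    ultimately show ?thesis
      unfolding infinitely_decomposed_flip using bl_flip by blast
  qed
  show ?thesis
    using 1 2 3 4 by auto
qed

end
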